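(* Let $G$ be a 2-connected non-bipartite graph. The following are equivalent: (i) $G$ is odd-$C_3^+$-free; (ii) $G$ has a totally odd circuit basis; (iii) every odd cycle basis of $G$ is totally odd.
   Context: Graphs are finite, may have parallel edges but no loops; $G$ contains $H$ if $H$ is a subgraph of $G$. A circuit is a connected 2-regular graph (identified with its edge set when convenient); a path is a circuit minus an edge. A totally odd subdivision of a graph $H$ is obtained by replacing each edge $e$ of $H$ by a path with an odd number of edges joining the ends of $e$, paths for distinct edges sharing no inner vertices. $C_3^+$ is the triangle $K_3$ with one edge doubled by a parallel edge. An odd-$C_3^+$ is a totally odd subdivision of $C_3^+$, and $G$ is odd-$C_3^+$-free if it contains no odd-$C_3^+$. A cycle of $G$ is an edge-disjoint union of circuits (a subgraph with all degrees even); the cycle space $\mathcal{C}(G)\subseteq\mathbb{F}_2^{E(G)}$ is spanned by incidence vectors of cycles. A cycle basis is a set of cycles whose incidence vectors form a basis of $\mathcal{C}(G)$ over $\mathbb{F}_2$; a circuit basis is a cycle basis consisting of circuits. A cycle is odd if it has an odd number of edges; a cycle basis is odd if all its elements are odd, and an odd cycle basis is totally odd if any two of its elements share an odd number of edges. *)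

theory Defs
  imports Complex_Main "HOL-Library.Z2" "HOL-Library.Function_Algebras" "HOL-Library.Disjoint_Sets"
begin

text \<open>Edges carry their own identity, so distinct edges may have the same set of ends.
  The value of \<open>ends\<close> outside \<open>edges\<close> is irrelevant.\<close>

record ('v, 'e) mgraph =
  verts :: "'v set"
  edges :: "'e set"
  ends :: "'e \<Rightarrow> 'v set"

definition multigraph :: "('v, 'e) mgraph \<Rightarrow> bool" where
  "multigraph G \<longleftrightarrow> finite (verts G) \<and> finite (edges G) \<and>
     (\<forall>e\<in>edges G. ends G e \<subseteq> verts G \<and> card (ends G e) = 2)"

definition subgraph :: "('v, 'e) mgraph \<Rightarrow> ('v, 'e) mgraph \<Rightarrow> bool" where
  "subgraph H G \<longleftrightarrow> multigraph H \<and> verts H \<subseteq> verts G \<and> edges H \<subseteq> edges G \<and>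
     (\<forall>e\<in>edges H. ends H e = ends G e)"

definition degree :: "('v, 'e) mgraph \<Rightarrow> 'v \<Rightarrow> nat" where
  "degree G v = card {e \<in> edges G. v \<in> ends G e}"

definition adjacency :: "('v, 'e) mgraph \<Rightarrow> ('v \<times> 'v) set" where
  "adjacency G = {(u, v). \<exists>e\<in>edges G. ends G e = {u, v}}"

definition connected_graph :: "('v, 'e) mgraph \<Rightarrow> bool" where
  "connected_graph G \<longleftrightarrow> verts G \<noteq> {} \<and>
     (\<forall>u\<in>verts G. \<forall>v\<in>verts G. (u, v) \<in> (adjacency G)\<^sup>*)"

definition delete_vertex :: "('v, 'e) mgraph \<Rightarrow> 'v \<Rightarrow> ('v, 'e) mgraph" where
  "delete_vertex G v =
     \<lparr>verts = verts G - {v}, edges = {e \<in> edges G. v \<notin> ends G e}, ends = ends G\<rparr>"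

definition two_connected :: "('v, 'e) mgraph \<Rightarrow> bool" where
  "two_connected G \<longleftrightarrow> card (verts G) > 2 \<and> connected_graph G \<and>
     (\<forall>v\<in>verts G. connected_graph (delete_vertex G v))"

definition bipartite_graph :: "('v, 'e) mgraph \<Rightarrow> bool" where
  "bipartite_graph G \<longleftrightarrow> (\<exists>X Y. X \<union> Y = verts G \<and> X \<inter> Y = {} \<and>
     (\<forall>e\<in>edges G. \<exists>x\<in>X. \<exists>y\<in>Y. ends G e = {x, y}))"


text \<open>Two parallel edges form a circuit of length two.\<close>

definition circuit_graph :: "('v, 'e) mgraph \<Rightarrow> bool" where
  "circuit_graph C \<longleftrightarrow> multigraph C \<and> connected_graph C \<and> (\<forall>v\<in>verts C. degree C v = 2)"

text \<open>A path is a circuit minus an edge, and its ends are the ends of the missing edge.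
  The missing edge need not be available in the edge type of the path, so it is
  represented by \<open>None\<close>.\<close>

definition add_new_edge :: "('v, 'e) mgraph \<Rightarrow> 'v set \<Rightarrow> ('v, 'e option) mgraph" where
  "add_new_edge P D =
     \<lparr>verts = verts P, edges = insert None (Some ` edges P), ends = case_option D (ends P)\<rparr>"

definition path_joining :: "'v set \<Rightarrow> ('v, 'e) mgraph \<Rightarrow> bool" where
  "path_joining D P \<longleftrightarrow> circuit_graph (add_new_edge P D)"

text \<open>\<open>\<phi>\<close> places the vertices of \<open>H\<close> in \<open>S\<close>, and \<open>P e\<close> is the path
  replacing the edge \<open>e\<close>; its inner vertices are those outside \<open>\<phi> ` ends H e\<close>.\<close>

definition totally_odd_subdivision :: "('a, 'b) mgraph \<Rightarrow> ('v, 'e) mgraph \<Rightarrow> bool" where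
  "totally_odd_subdivision H S \<longleftrightarrow> multigraph S \<and>
     (\<exists>(\<phi> :: 'a \<Rightarrow> 'v) (P :: 'b \<Rightarrow> ('v, 'e) mgraph).
        inj_on \<phi> (verts H) \<and>
        (\<forall>e\<in>edges H. subgraph (P e) S \<and> path_joining (\<phi> ` ends H e) (P e) \<and>
           odd (card (edges (P e))) \<and>
           (verts (P e) - \<phi> ` ends H e) \<inter> \<phi> ` verts H = {}) \<and>
        (\<forall>e\<in>edges H. \<forall>f\<in>edges H. e \<noteq> f \<longrightarrow>
           edges (P e) \<inter> edges (P f) = {} \<and>
           (verts (P e) - \<phi> ` ends H e) \<inter> (verts (P f) - \<phi> ` ends H f) = {}) \<and>
        verts S = \<phi> ` verts H \<union> (\<Union>e\<in>edges H. verts (P e)) \<and>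
        edges S = (\<Union>e\<in>edges H. edges (P e)))"

definition C3_plus :: "(nat, nat) mgraph" where
  "C3_plus = \<lparr>verts = {0, 1, 2}, edges = {0, 1, 2, 3},
     ends = (\<lambda>i. [{0, 1}, {1, 2}, {0, 2}, {0, 2}] ! i)\<rparr>"

definition odd_C3_plus_free :: "('v, 'e) mgraph \<Rightarrow> bool" where
  "odd_C3_plus_free G \<longleftrightarrow> \<not> (\<exists>S. subgraph S G \<and> totally_odd_subdivision C3_plus S)"


text \<open>Circuits and cycles of \<open>G\<close> are identified with their edge sets.\<close>

definition circuits :: "('v, 'e) mgraph \<Rightarrow> 'e set set" where
  "circuits G = {edges C | C. subgraph C G \<and> circuit_graph C}"

definition cycles :: "('v, 'e) mgraph \<Rightarrow> 'e set set" where
  "cycles G = {\<Union>\<C> | \<C>. \<C> \<subseteq> circuits G \<and> disjoint \<C>}"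

text \<open>Vectors over \<open>\<bbbF>\<^sub>2\<close> indexed by the edges of \<open>G\<close> are represented as functions
  on the whole edge type that vanish outside \<open>edges G\<close>; type \<open>bit\<close> is the field
  with two elements.\<close>

definition F2_scale :: "bit \<Rightarrow> ('e \<Rightarrow> bit) \<Rightarrow> ('e \<Rightarrow> bit)" where
  "F2_scale c x = (\<lambda>e. c * x e)"

global_interpretation F2: vector_space F2_scale
  by unfold_locales
    (auto simp only: F2_scale_def fun_eq_iff plus_fun_apply distrib_left distrib_right mult.assoc mult_1_left)

definition incidence_vector :: "'e set \<Rightarrow> ('e \<Rightarrow> bit)" where
  "incidence_vector C = (\<lambda>e. of_bool (e \<in> C))"

definition cycle_space :: "('v, 'e) mgraph \<Rightarrow> ('e \<Rightarrow> bit) set" where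
  "cycle_space G = F2.span (incidence_vector ` cycles G)"

definition cycle_basis :: "('v, 'e) mgraph \<Rightarrow> 'e set set \<Rightarrow> bool" where
  "cycle_basis G B \<longleftrightarrow> B \<subseteq> cycles G \<and> F2.independent (incidence_vector ` B) \<and>
     F2.span (incidence_vector ` B) = cycle_space G"

definition circuit_basis :: "('v, 'e) mgraph \<Rightarrow> 'e set set \<Rightarrow> bool" where
  "circuit_basis G B \<longleftrightarrow> cycle_basis G B \<and> B \<subseteq> circuits G"

definition odd_cycle_basis :: "('v, 'e) mgraph \<Rightarrow> 'e set set \<Rightarrow> bool" where
  "odd_cycle_basis G B \<longleftrightarrow> cycle_basis G B \<and> (\<forall>C\<in>B. odd (card C))"

definition totally_odd_cycle_basis :: "('v, 'e) mgraph \<Rightarrow> 'e set set \<Rightarrow> bool" where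
  "totally_odd_cycle_basis G B \<longleftrightarrow> odd_cycle_basis G B \<and>
     (\<forall>C\<in>B. \<forall>D\<in>B. C \<noteq> D \<longrightarrow> odd (card (C \<inter> D)))"

end

theory Submission
  imports Defs
begin

text \<open>An odd cycle basis is totally odd iff \<open>|C \<inter> D| \<equiv> |C| \<cdot> |D|\<close> modulo 2 holds on the whole
  cycle space, by bilinearity; so the choice of the odd basis is irrelevant.
  An odd-\<open>C\<^sub>3\<^sup>+\<close> is a theta graph with two odd paths and one even path. It violates this identity, and
  it is absent iff every ear of every odd circuit has even length.

  Both remaining points follow from one lemma on ears. Let \<open>c\<close> be a 2-colouring of a vertex
  set \<open>S\<close> such that the length of every ear of \<open>S\<close> has the parity predicted by the colours of
  its ends. Adding ears one by one preserves this property, so 2-connectivity extends \<open>c\<close> to a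
  colouring for which every edge that may occur in an ear is bichromatic. If \<open>S\<close> is the vertex
  set of an odd circuit \<open>C\<close> with only even ears and \<open>c\<close> is constant, then every circuit has an even
  number of edges outside \<open>C\<close>. If \<open>S\<close> is the vertex set of an even circuit \<open>D\<close> and \<open>c\<close> is its
  proper colouring, then a non-bipartite graph must contain an ear of the wrong parity, which
  exhibits \<open>D\<close> as a sum of two odd circuits; hence the odd circuits span the cycle space.\<close>

section \<open>Arcs\<close>

text \<open>\<open>F\<close> and \<open>W\<close> are the edge set and the vertex set of a path from \<open>u\<close> to \<open>v\<close>;
  for \<open>u = v\<close> the path is trivial.\<close>

inductive arc :: "('e \<Rightarrow> 'v set) \<Rightarrow> 'v \<Rightarrow> 'e set \<Rightarrow> 'v set \<Rightarrow> 'v \<Rightarrow> bool"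
  for en :: "'e \<Rightarrow> 'v set" where
  arc_Nil: "arc en u {} {u} u"
| arc_Cons: "en e = {u, w} \<Longrightarrow> arc en w F W v \<Longrightarrow> u \<notin> W \<Longrightarrow>
    arc en u (insert e F) (insert u W) v"

lemma arc_endpoints: "arc en u F W v \<Longrightarrow> u \<in> W \<and> v \<in> W"
  by (induction rule: arc.induct) auto

lemma arc_finite: "arc en u F W v \<Longrightarrow> finite F \<and> finite W"
  by (induction rule: arc.induct) auto

lemma arc_ends_subset: "arc en u F W v \<Longrightarrow> e \<in> F \<Longrightarrow> en e \<subseteq> W"
  by (induction rule: arc.induct) (auto dest: arc_endpoints)

lemma arc_card_ends: "arc en u F W v \<Longrightarrow> e \<in> F \<Longrightarrow> card (en e) = 2"
proof (induction rule: arc.induct)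
  case (arc_Cons e' u w F W v)
  have "u \<noteq> w" using arc_Cons.hyps(3) arc_endpoints[OF arc_Cons.hyps(2)] by auto
  then show ?case using arc_Cons by auto
qed simp

lemma arc_trivial: "arc en u F W u \<Longrightarrow> F = {} \<and> W = {u}"
  by (erule arc.cases) (auto dest: arc_endpoints)

lemma arc_cong:
  "arc en u F W v \<Longrightarrow> (\<And>e. e \<in> F \<Longrightarrow> en' e = en e) \<Longrightarrow> arc en' u F W v"
  by (induction rule: arc.induct) (auto intro: arc.intros)

lemma arc_single: "en e = {u, v} \<Longrightarrow> u \<noteq> v \<Longrightarrow> arc en u {e} {u, v} v"
  using arc_Cons[of en e u v "{}" "{v}" v] by (simp add: arc_Nil)

lemma arc_verts: "arc en u F W v \<Longrightarrow> u \<noteq> v \<Longrightarrow> W = (\<Union>e\<in>F. en e)"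
proof (induction rule: arc.induct)
  case (arc_Cons e u w F W v)
  show ?case
  proof (cases "w = v")
    case True
    then show ?thesis using arc_Cons arc_trivial by fastforce
  next
    case False
    then show ?thesis using arc_Cons arc_endpoints by fastforce
  qed
qed simp

lemma arc_append:
  "arc en u F W v \<Longrightarrow> arc en v F' W' x \<Longrightarrow> W \<inter> W' = {v} \<Longrightarrow> arc en u (F \<union> F') (W \<union> W') x"
proof (induction rule: arc.induct)
  case (arc_Nil u)
  then show ?case using arc_endpoints by (metis Un_empty_left insert_absorb insert_is_Un)
next
  case (arc_Cons e u w F W v)
  have "v \<in> W" using arc_Cons arc_endpoints by metis
  then have "W \<inter> W' = {v}" "u \<notin> W'" using arc_Cons.prems(2) arc_Cons.hyps(3) by auto
  then show ?case using arc_Cons arc.arc_Cons[of en e u w "F \<union> F'" "W \<union> W'" x] by auto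
qed

lemma arc_reverse: "arc en u F W v \<Longrightarrow> arc en v F W u"
proof (induction rule: arc.induct)
  case (arc_Nil u)
  then show ?case by (rule arc.arc_Nil)
next
  case (arc_Cons e u w F W v)
  have w: "w \<in> W" using arc_Cons arc_endpoints by metis
  then have "arc en w {e} {w, u} u"
    using arc_Cons by (intro arc_single) auto
  moreover have "W \<inter> {w, u} = {w}" using w arc_Cons by auto
  ultimately have "arc en v (F \<union> {e}) (W \<union> {w, u}) u" using arc_Cons arc_append by metis
  moreover have "W \<union> {w, u} = insert u W" using w by auto
  ultimately show ?case by simp
qed

lemma arc_split:
  "arc en u F W v \<Longrightarrow> x \<in> W \<Longrightarrow>
    \<exists>F1 W1 F2 W2. arc en u F1 W1 x \<and> arc en x F2 W2 v \<and> W1 \<inter> W2 = {x} \<and>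
      F1 \<union> F2 = F \<and> F1 \<inter> F2 = {} \<and> W1 \<union> W2 = W"
proof (induction rule: arc.induct)
  case (arc_Nil u)
  then show ?case using arc.arc_Nil by fastforce
next
  case (arc_Cons e u w F W v)
  have e: "e \<notin> F" using arc_Cons arc_ends_subset by fastforce
  show ?case
  proof (cases "x = u")
    case True
    have "arc en u (insert e F) (insert u W) v" using arc_Cons by (intro arc.arc_Cons)
    then show ?thesis
      by (intro exI[of _ "{}"] exI[of _ "{u}"] exI[of _ "insert e F"] exI[of _ "insert u W"])
        (auto simp: True intro: arc.arc_Nil)
  next
    case False
    then obtain F1 W1 F2 W2 where *: "arc en w F1 W1 x" "arc en x F2 W2 v" "W1 \<inter> W2 = {x}"
        "F1 \<union> F2 = F" "F1 \<inter> F2 = {}" "W1 \<union> W2 = W"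
      using arc_Cons by blast
    have "arc en u (insert e F1) (insert u W1) x"
      using * arc_Cons by (intro arc.arc_Cons) auto
    then show ?thesis
      using * arc_Cons e
      by (intro exI[of _ "insert e F1"] exI[of _ "insert u W1"] exI[of _ F2] exI[of _ W2]) auto
  qed
qed

text \<open>Cutting the arc at its first vertex in \<open>S\<close> leaves a piece that touches
  \<open>S\<close> only at its end; this is how ears get their far end.\<close>

lemma arc_first_hit:
  "arc en u F W v \<Longrightarrow> v \<in> S \<Longrightarrow> u \<notin> S \<Longrightarrow>
    \<exists>F' W' t. arc en u F' W' t \<and> F' \<subseteq> F \<and> W' \<subseteq> W \<and> W' \<inter> S = {t}"
proof (induction rule: arc.induct)
  case (arc_Cons e u w F W v)
  have w: "w \<in> W" using arc_Cons arc_endpoints by metis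
  show ?case
  proof (cases "w \<in> S")
    case True
    have "arc en u {e} {u, w} w" using arc_Cons w by (intro arc_single) auto
    then show ?thesis using True w arc_Cons by (intro exI[of _ "{e}"] exI[of _ "{u, w}"]) auto
  next
    case False
    then obtain F' W' t where *: "arc en w F' W' t" "F' \<subseteq> F" "W' \<subseteq> W" "W' \<inter> S = {t}"
      using arc_Cons by blast
    have "arc en u (insert e F') (insert u W') t"
      using * arc_Cons by (intro arc.arc_Cons) auto
    then show ?thesis
      using * arc_Cons by (intro exI[of _ "insert e F'"] exI[of _ "insert u W'"] exI[of _ t]) auto
  qed
qed simp

text \<open>If \<open>e\<close> is the first edge, the rest runs from \<open>v\<close> to
  \<open>v\<close> and is trivial. Otherwise \<open>e\<close> belongs to the rest, whose vertices
  avoid \<open>u\<close>, which is impossible.\<close>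

lemma arc_edge_joining_ends:
  assumes "arc en u F W v" "e \<in> F" "en e = {u, v}"
  shows "W = {u, v}"
  using assms
proof (cases rule: arc.cases)
  case (arc_Cons e' w F' W')
  show ?thesis
  proof (cases "e = e'")
    case True
    then have "w = v" using arc_Cons assms arc_endpoints by (metis doubleton_eq_iff)
    then show ?thesis using arc_Cons arc_trivial by fastforce
  next
    case False
    then show ?thesis using arc_Cons assms arc_ends_subset by fastforce
  qed
qed simp

lemma arc_degree:
  "arc en u F W v \<Longrightarrow> u \<noteq> v \<Longrightarrow>
    card {e \<in> F. x \<in> en e} = (if x \<notin> W then 0 else if x = u \<or> x = v then 1 else 2)"
proof (induction rule: arc.induct)
  case (arc_Cons e u w F W v)
  have w: "w \<in> W" "v \<in> W" using arc_Cons arc_endpoints by metis+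
  have e: "e \<notin> F" using arc_Cons arc_ends_subset by fastforce
  have fin: "finite F" using arc_Cons arc_finite by metis
  have "{d \<in> insert e F. x \<in> en d} = (if x \<in> {u, w} then insert e {d \<in> F. x \<in> en d} else {d \<in> F. x \<in> en d})"
    using arc_Cons(1) by auto
  then have card: "card {d \<in> insert e F. x \<in> en d} = (if x \<in> {u, w} then 1 else 0) + card {d \<in> F. x \<in> en d}"
    using e fin by auto
  show ?case
  proof (cases "w = v")
    case True
    then have "F = {}" "W = {v}" using arc_Cons arc_trivial by metis+
    then show ?thesis unfolding card using True arc_Cons by auto
  next
    case False
    then show ?thesis unfolding card using arc_Cons w by auto
  qed
qed simp

section \<open>Reachability along a set of edges\<close>

text \<open>Taking a bare edge set as argument allows reachability to be studied after deleting
  edges, without forming a new graph.\<close>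

definition adj :: "('e \<Rightarrow> 'v set) \<Rightarrow> 'e set \<Rightarrow> ('v \<times> 'v) set" where
  "adj en E = {(u, v). \<exists>e\<in>E. en e = {u, v}}"

lemma adjacency_eq_adj: "adjacency G = adj (ends G) (edges G)"
  by (simp add: adjacency_def adj_def)

lemma adj_mono: "E \<subseteq> E' \<Longrightarrow> adj en E \<subseteq> adj en E'"
  by (auto simp: adj_def)

lemma sym_adj_rtrancl: "sym ((adj en E)\<^sup>*)"
  by (rule sym_rtrancl) (auto simp: sym_def adj_def insert_commute)

lemma arc_reaches:
  "arc en u F W v \<Longrightarrow> x \<in> W \<Longrightarrow> (u, x) \<in> (adj en F)\<^sup>*"
proof (induction rule: arc.induct)
  case (arc_Cons e u w F W v)
  show ?case
  proof (cases "x = u")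
    case False
    then have "(w, x) \<in> (adj en F)\<^sup>*" using arc_Cons by auto
    then have "(w, x) \<in> (adj en (insert e F))\<^sup>*"
      using rtrancl_mono[OF adj_mono[of F "insert e F" en]] by auto
    moreover have "(u, w) \<in> adj en (insert e F)" using arc_Cons by (auto simp: adj_def)
    ultimately show ?thesis by (rule converse_rtrancl_into_rtrancl[rotated])
  qed simp
qed simp

text \<open>A walk is shortened from its end backwards: when the new first vertex already lies on
  the arc built so far, only the part of the arc from that vertex on is kept.\<close>

lemma reaches_imp_arc:
  assumes "(u, v) \<in> (adj en E)\<^sup>*"
  shows "\<exists>F W. arc en u F W v \<and> F \<subseteq> E"
  using assms
proof (induction rule: converse_rtrancl_induct)
  case base
  then show ?case using arc_Nil by fastforce
next
  case (step u w)
  then obtain F W e where *: "arc en w F W v" "F \<subseteq> E" "e \<in> E" "en e = {u, w}"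
    by (auto simp: adj_def)
  show ?case
  proof (cases "u \<in> W")
    case True
    then show ?thesis using arc_split[OF *(1) True] *(2) by blast
  next
    case False
    then have "arc en u (insert e F) (insert u W) v" using * by (intro arc_Cons)
    then show ?thesis using * by blast
  qed
qed

section \<open>Colourings and parity\<close>

text \<open>Ranging over all presentations of the ends avoids choosing an order of the two ends. An
  end set with more than two elements satisfies the condition vacuously, but no edge of a multigraph
  has one.\<close>

definition bichromatic :: "('e \<Rightarrow> 'v set) \<Rightarrow> ('v \<Rightarrow> bool) \<Rightarrow> 'e \<Rightarrow> bool" where
  "bichromatic en c e \<longleftrightarrow> (\<forall>x y. en e = {x, y} \<longrightarrow> c x \<noteq> c y)"

text \<open>Colours alternate along the arc. The first vertex does not occur in the rest of the arc,
  so recolouring it disturbs no later edge.\<close>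

lemma arc_colouring_exists:
  "arc en u F W v \<Longrightarrow> \<exists>c. c u = k \<and> (\<forall>e\<in>F. bichromatic en c e)"
proof (induction arbitrary: k rule: arc.induct)
  case (arc_Cons e u w F W v)
  then obtain c where c: "c w = (\<not> k)" "\<forall>e\<in>F. bichromatic en c e" by blast
  have w: "w \<in> W" using arc_Cons arc_endpoints by metis
  have "bichromatic en (c(u := k)) d" if "d \<in> F" for d
  proof -
    have u: "u \<notin> en d" using arc_ends_subset[OF arc_Cons.hyps(2) that] arc_Cons.hyps(3) by auto
    show ?thesis
      unfolding bichromatic_def
    proof (intro allI impI)
      fix x y
      assume xy: "en d = {x, y}"
      then have "c x \<noteq> c y" using c(2) that by (auto simp: bichromatic_def)
      then show "(c(u := k)) x \<noteq> (c(u := k)) y" using u xy by auto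
    qed
  qed
  moreover have "bichromatic en (c(u := k)) e"
    using arc_Cons.hyps(1,3) w c(1) by (auto simp: bichromatic_def doubleton_eq_iff)
  moreover have "(c(u := k)) u = k" by simp
  ultimately show ?case by blast
qed auto

text \<open>Each edge flips the colour. Lengths of arcs are thus read off modulo 2 from the colours
  of their ends, the form in which parity is used throughout.\<close>

lemma arc_parity:
  "arc en u F W v \<Longrightarrow> (\<And>e. e \<in> F \<Longrightarrow> bichromatic en c e) \<Longrightarrow> odd (card F) \<longleftrightarrow> c u \<noteq> c v"
proof (induction rule: arc.induct)
  case (arc_Cons e u w F W v)
  have e: "e \<notin> F" using arc_Cons arc_ends_subset by fastforce
  have fin: "finite F" using arc_Cons arc_finite by metis
  have "c u \<noteq> c w" using arc_Cons.prems[of e] arc_Cons.hyps(1) by (auto simp: bichromatic_def)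
  moreover have "odd (card F) \<longleftrightarrow> c w \<noteq> c v" using arc_Cons by blast
  ultimately show ?case using e fin by auto
qed simp

section \<open>Handshake arguments\<close>

lemma sum_degrees:
  assumes "finite K" "finite F"
  shows "(\<Sum>x\<in>K. card {e \<in> F. x \<in> en e}) = (\<Sum>e\<in>F. card (en e \<inter> K))"
proof -
  have "card {e \<in> F. x \<in> en e} = (\<Sum>e\<in>F. of_bool (x \<in> en e))" for x
    using assms by (simp add: sum.If_cases Int_def of_bool_def)
  moreover have "card (en e \<inter> K) = (\<Sum>x\<in>K. of_bool (x \<in> en e))" for e
    using assms by (simp add: sum.If_cases Int_def of_bool_def conj_commute)
  ultimately show ?thesis by (simp add: sum.swap[of _ K F])
qed

text \<open>Every edge has none or both of its ends in the component of \<open>u\<close>, so the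
  degrees in this component have an even sum. Hence it contains a second vertex of odd degree, and
  only \<open>v\<close> can be one.\<close>

lemma reaches_other_odd_vertex:
  assumes fin: "finite F" and two: "\<And>e. e \<in> F \<Longrightarrow> card (en e) = 2"
    and u: "odd (card {e \<in> F. u \<in> en e})"
    and even: "\<And>x. x \<noteq> u \<Longrightarrow> x \<noteq> v \<Longrightarrow> even (card {e \<in> F. x \<in> en e})"
  shows "(u, v) \<in> (adj en F)\<^sup>*"
proof (rule ccontr)
  assume v: "(u, v) \<notin> (adj en F)\<^sup>*"
  define K where "K = {x. (u, x) \<in> (adj en F)\<^sup>*}"
  have "x \<in> insert u (\<Union>e\<in>F. en e)" if "(u, x) \<in> (adj en F)\<^sup>*" for x
    using that by (induction rule: rtrancl_induct) (auto simp: adj_def)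
  then have "K \<subseteq> insert u (\<Union>e\<in>F. en e)" by (auto simp: K_def)
  moreover have "finite (en e)" if "e \<in> F" for e using two[OF that] by (metis card.infinite zero_neq_numeral)
  ultimately have finK: "finite K" using fin by (meson finite_UN finite_insert finite_subset)
  have "even (card (en e \<inter> K))" if e: "e \<in> F" for e
  proof -
    obtain x y where xy: "en e = {x, y}" using two[OF e] by (meson card_2_iff)
    then have "(x, y) \<in> adj en F" "(y, x) \<in> adj en F" using e by (auto simp: adj_def)
    then have "x \<in> K \<longleftrightarrow> y \<in> K" unfolding K_def by (auto intro: rtrancl_into_rtrancl)
    then have "en e \<inter> K = {} \<or> en e \<inter> K = en e" using xy by auto
    then show ?thesis using two[OF e] by auto
  qed
  then have "even (\<Sum>x\<in>K. card {e \<in> F. x \<in> en e})"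
    unfolding sum_degrees[OF finK fin] by (rule dvd_sum)
  moreover have "u \<in> K" by (simp add: K_def)
  then have "(\<Sum>x\<in>K. card {e \<in> F. x \<in> en e}) =
      card {e \<in> F. u \<in> en e} + (\<Sum>x\<in>K - {u}. card {e \<in> F. x \<in> en e})"
    by (rule sum.remove[OF finK])
  moreover have "even (\<Sum>x\<in>K - {u}. card {e \<in> F. x \<in> en e})"
    using v by (intro dvd_sum even) (auto simp: K_def)
  ultimately show False using u by simp
qed

text \<open>The bichromatic edges of \<open>F\<close> are those in the cut between the colour
  classes, and an edge set with even degrees meets every cut evenly. The proof sums the degrees over
  one colour class: an edge contributes an odd number exactly when it crosses.\<close>

lemma even_bichromatic_edges:
  assumes fin: "finite F" and two: "\<And>e. e \<in> F \<Longrightarrow> card (en e) = 2"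
    and even: "\<And>x. even (card {e \<in> F. x \<in> en e})"
  shows "even (card {e \<in> F. bichromatic en c e})"
proof -
  define K where "K = {x \<in> (\<Union>e\<in>F. en e). c x}"
  have "finite (en e)" if "e \<in> F" for e using two[OF that] by (metis card.infinite zero_neq_numeral)
  then have finK: "finite K" using fin by (auto simp: K_def)
  have odd: "odd (card (en e \<inter> K)) \<longleftrightarrow> bichromatic en c e" if e: "e \<in> F" for e
  proof -
    obtain x y where xy: "en e = {x, y}" "x \<noteq> y" using two[OF e] by (meson card_2_iff)
    have "en e \<inter> K = {z \<in> {x, y}. c z}" using xy e by (auto simp: K_def)
    also have "\<dots> = (if c x then {x} else {}) \<union> (if c y then {y} else {})" by auto
    finally show ?thesis using xy by (auto simp: bichromatic_def doubleton_eq_iff)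
  qed
  have "even (\<Sum>x\<in>K. card {e \<in> F. x \<in> en e})" using even by (intro dvd_sum)
  then have "even (\<Sum>e\<in>F. card (en e \<inter> K))" using sum_degrees[OF finK fin] by simp
  then have "even (card {e \<in> F. odd (card (en e \<inter> K))})"
    using even_sum_iff[OF fin, of "\<lambda>e. card (en e \<inter> K)"] by simp
  moreover have "{e \<in> F. odd (card (en e \<inter> K))} = {e \<in> F. bichromatic en c e}" using odd by auto
  ultimately show ?thesis by simp
qed

section \<open>Ears\<close>

lemma multigraph_edge:
  assumes "multigraph G" "e \<in> edges G"
  obtains x y where "ends G e = {x, y}" "x \<noteq> y" "x \<in> verts G" "y \<in> verts G"
  using assms by (metis card_2_iff insert_subset multigraph_def)

lemma arc_verts_subset:
  assumes "multigraph G" "arc (ends G) u F W v" "u \<noteq> v" "F \<subseteq> edges G"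
  shows "W \<subseteq> verts G"
  using arc_verts[OF assms(2,3)] assms(1,4) by (auto simp: multigraph_def)

lemma rtrancl_leaves_set:
  assumes "(a, b) \<in> r\<^sup>*" "a \<in> S" "b \<notin> S"
  shows "\<exists>x y. (x, y) \<in> r \<and> x \<in> S \<and> y \<notin> S"
  using assms by (induction rule: rtrancl_induct) auto

text \<open>Some edge leaves \<open>S\<close>, from \<open>s\<close> to \<open>x\<close>. Deleting
  \<open>s\<close> does not separate \<open>x\<close> from a further vertex \<open>t\<close> of
  \<open>S\<close>, and the arc from \<open>x\<close> to \<open>t\<close> is stopped where it first
  meets \<open>S\<close>. The ear brings in a new vertex, so adding ears one by one
  terminates.\<close>

lemma ear_exists:
  assumes G: "multigraph G" "two_connected G"
    and S: "S \<subset> verts G" "a \<in> S" "b \<in> S" "a \<noteq> b"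
  shows "\<exists>u v F W. arc (ends G) u F W v \<and> u \<noteq> v \<and> W \<inter> S = {u, v} \<and> F \<subseteq> edges G \<and> \<not> W \<subseteq> S"
proof -
  obtain z where z: "z \<in> verts G" "z \<notin> S" using S by blast
  have "(a, z) \<in> (adj (ends G) (edges G))\<^sup>*"
    using G S z by (auto simp: two_connected_def connected_graph_def adjacency_eq_adj)
  then obtain s x where sx: "(s, x) \<in> adj (ends G) (edges G)" "s \<in> S" "x \<notin> S"
    using rtrancl_leaves_set[OF _ S(2) z(2)] by blast
  then obtain e where e: "e \<in> edges G" "ends G e = {s, x}" by (auto simp: adj_def)
  obtain t where t: "t \<in> S" "t \<noteq> s" using S by metis
  have x: "x \<in> verts G" "x \<noteq> s" using e G sx by (auto simp: multigraph_def)
  let ?E = "{e \<in> edges G. s \<notin> ends G e}"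
  have "connected_graph (delete_vertex G s)" using G S sx by (auto simp: two_connected_def)
  then have xt: "(x, t) \<in> (adj (ends G) ?E)\<^sup>*"
    using x t S by (auto simp: connected_graph_def adjacency_eq_adj delete_vertex_def)
  obtain F W where FW: "arc (ends G) x F W t" "F \<subseteq> ?E"
    using reaches_imp_arc[OF xt] by blast
  obtain F' W' t' where FW': "arc (ends G) x F' W' t'" "F' \<subseteq> F" "W' \<subseteq> W" "W' \<inter> S = {t'}"
    using arc_first_hit[OF FW(1) t(1) sx(3)] by blast
  have "x \<noteq> t'" using FW' sx by auto
  then have "s \<notin> W'" using arc_verts[OF FW'(1)] FW'(2) FW(2) by auto
  then have "arc (ends G) s (insert e F') (insert s W') t'"
    using e FW' by (intro arc_Cons[of "ends G" e s x])
  moreover have "s \<noteq> t'" using \<open>s \<notin> W'\<close> arc_endpoints[OF FW'(1)] by auto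
  moreover have "insert s W' \<inter> S = {s, t'}" using FW' sx by auto
  moreover have "insert e F' \<subseteq> edges G" using FW FW' e by auto
  moreover have "\<not> insert s W' \<subseteq> S" using sx arc_endpoints[OF FW'(1)] by auto
  ultimately show ?thesis by blast
qed

section \<open>Colourings that predict the parity of ears\<close>

text \<open>Single edges between vertices of \<open>S\<close> count as ears. In the applications
  \<open>S\<close> is the vertex set of a circuit, and \<open>E\<close> excludes the edges of that
  circuit, which would otherwise be ears themselves.\<close>

definition consistent_ears ::
  "('e \<Rightarrow> 'v set) \<Rightarrow> 'e set \<Rightarrow> 'v set \<Rightarrow> ('v \<Rightarrow> bool) \<Rightarrow> bool" where
  "consistent_ears en E S c \<longleftrightarrow> (\<forall>u v F W. arc en u F W v \<longrightarrow> u \<noteq> v \<longrightarrow> W \<inter> S = {u, v} \<longrightarrow>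
     F \<subseteq> E \<longrightarrow> (odd (card F) \<longleftrightarrow> c u \<noteq> c v))"

lemma consistent_earsD:
  "consistent_ears en E S c \<Longrightarrow> arc en u F W v \<Longrightarrow> u \<noteq> v \<Longrightarrow> W \<inter> S = {u, v} \<Longrightarrow> F \<subseteq> E \<Longrightarrow>
    odd (card F) \<longleftrightarrow> c u \<noteq> c v"
  unfolding consistent_ears_def by blast

text \<open>A common edge would have both of its distinct ends in a one-element set.\<close>

lemma arcs_edge_disjoint:
  assumes "arc en u F W v" "arc en u' F' W' v'" "W \<inter> W' \<subseteq> {x}"
  shows "F \<inter> F' = {}"
proof (rule ccontr)
  assume "F \<inter> F' \<noteq> {}"
  then obtain e where e: "e \<in> F" "e \<in> F'" by auto
  then have "en e \<subseteq> {x}" using arc_ends_subset[OF assms(1) e(1)] arc_ends_subset[OF assms(2) e(2)] assms(3) by auto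
  then have "card (en e) \<le> 1" using card_mono[of "{x}" "en e"] by simp
  then show False using arc_card_ends[OF assms(1) e(1)] by simp
qed

lemma card_arc_append:
  assumes "arc en u F W v" "arc en u' F' W' v'" "W \<inter> W' \<subseteq> {x}"
  shows "card (F \<union> F') = card F + card F'"
  using arcs_edge_disjoint[OF assms] arc_finite[OF assms(1)] arc_finite[OF assms(2)]
  by (simp add: card_Un_disjoint)

text \<open>An ear of \<open>S \<union> W\<close> is completed by pieces of the ear \<open>W\<close> to an ear of \<open>S\<close>.\<close>

lemma consistent_ears_extend_one_side:
  assumes cons: "consistent_ears en E S c"
    and P: "arc en u F W v" "u \<noteq> v" "W \<inter> S = {u, v}" "F \<subseteq> E"
    and c': "\<And>e. e \<in> F \<Longrightarrow> bichromatic en c' e" "\<And>x. x \<in> S \<Longrightarrow> c' x = c x"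
    and Q: "arc en p F' W' q" "W' \<inter> (S \<union> W) = {p, q}" "F' \<subseteq> E" "p \<in> S" "q \<notin> S" "q \<in> W"
    and p: "p \<noteq> v"
  shows "odd (card F') \<longleftrightarrow> c' p \<noteq> c' q"
proof -
  obtain F1 W1 F2 W2 where s: "arc en u F1 W1 q" "arc en q F2 W2 v" "W1 \<inter> W2 = {q}"
      "F1 \<union> F2 = F" "W1 \<union> W2 = W"
    using arc_split[OF P(1) Q(6)] by blast
  have uv: "u \<in> S" "v \<in> S" "u \<in> W1" "v \<in> W2" using P(3) arc_endpoints[OF s(1)] arc_endpoints[OF s(2)] by auto
  have W2S: "W2 \<inter> S = {v}"
  proof -
    have "u \<notin> W2" using s(3) uv Q(5) by auto
    moreover have "W2 \<inter> S \<subseteq> {u, v}" using P(3) s(5) by auto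
    ultimately show ?thesis using uv by auto
  qed
  then have "p \<notin> W2" using Q(4) p by auto
  moreover have "q \<in> W2" "q \<in> W'" using arc_endpoints[OF s(2)] arc_endpoints[OF Q(1)] by auto
  ultimately have int: "W' \<inter> W2 = {q}" using Q(2) s(5) by auto
  have "arc en p (F' \<union> F2) (W' \<union> W2) v" using arc_append[OF Q(1) s(2) int] .
  moreover have "(W' \<union> W2) \<inter> S = {p, v}" using Q(2,4,5) W2S by auto
  moreover have "F' \<union> F2 \<subseteq> E" using Q(3) P(4) s(4) by auto
  ultimately have "odd (card (F' \<union> F2)) \<longleftrightarrow> c p \<noteq> c v"
    using consistent_earsD[OF cons] p by blast
  moreover have "card (F' \<union> F2) = card F' + card F2"
    using int by (intro card_arc_append[OF Q(1) s(2)]) auto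
  moreover have "odd (card F2) \<longleftrightarrow> c' q \<noteq> c' v" using s c' by (intro arc_parity[OF s(2)]) auto
  ultimately show ?thesis using c'(2) uv Q(4) by auto
qed

text \<open>Here the new arc joins two inner vertices of the old ear. Replacing the piece between
  \<open>p\<close> and \<open>q\<close> by the new arc gives another ear of \<open>S\<close> from
  \<open>u\<close> to \<open>v\<close>. The colouring \<open>c'\<close> determines the parity of the
  two retained pieces, and so of the new arc.\<close>

lemma consistent_ears_extend_two_sides:
  assumes cons: "consistent_ears en E S c"
    and P: "arc en u F1 W1 p" "arc en p F2 W2 v" "W1 \<inter> W2 = {p}" "(W1 \<union> W2) \<inter> S = {u, v}"
      "F1 \<union> F2 \<subseteq> E" "u \<noteq> v"
    and c': "\<And>e. e \<in> F1 \<union> F2 \<Longrightarrow> bichromatic en c' e" "\<And>x. x \<in> S \<Longrightarrow> c' x = c x"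
    and Q: "arc en p F' W' q" "W' \<inter> (S \<union> (W1 \<union> W2)) = {p, q}" "F' \<subseteq> E" "p \<notin> S" "q \<notin> S"
      "q \<in> W2" "p \<noteq> q"
  shows "odd (card F') \<longleftrightarrow> c' p \<noteq> c' q"
proof -
  obtain F3 W3 F4 W4 where s: "arc en p F3 W3 q" "arc en q F4 W4 v" "W3 \<inter> W4 = {q}"
      "F3 \<union> F4 = F2" "W3 \<union> W4 = W2"
    using arc_split[OF P(2) Q(6)] by blast
  have mem: "p \<in> W1" "p \<in> W'" "q \<in> W'" "q \<in> W4" "p \<in> W3" "u \<in> W1" "v \<in> W4"
    using arc_endpoints[OF P(1)] arc_endpoints[OF s(1)] arc_endpoints[OF s(2)] arc_endpoints[OF Q(1)]
    by auto
  have q1: "q \<notin> W1" using P(3) Q(6,7) by auto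
  have p4: "p \<notin> W4" using s(3) mem Q(7) by auto
  have uS: "u \<in> S" "v \<in> S" using P(4) by auto
  have int1: "W1 \<inter> W' = {p}" using Q(2) mem q1 by auto
  have a1: "arc en u (F1 \<union> F') (W1 \<union> W') q" using arc_append[OF P(1) Q(1) int1] .
  have int2: "(W1 \<union> W') \<inter> W4 = {q}"
  proof -
    have "W1 \<inter> W4 \<subseteq> {p}" using P(3) s(5) by auto
    moreover have "W' \<inter> W4 \<subseteq> {p, q}" using Q(2) s(5) by auto
    ultimately show ?thesis using p4 mem by auto
  qed
  have a2: "arc en u (F1 \<union> F' \<union> F4) (W1 \<union> W' \<union> W4) v" using arc_append[OF a1 s(2) int2] .
  moreover have "(W1 \<union> W' \<union> W4) \<inter> S = {u, v}"
  proof -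
    have "W' \<inter> S \<subseteq> {p, q}" using Q(2) by auto
    then have "W' \<inter> S = {}" using Q(4,5) by auto
    then show ?thesis using P(4) s(5) mem uS by auto
  qed
  moreover have "F1 \<union> F' \<union> F4 \<subseteq> E" using P(5) Q(3) s(4) by auto
  ultimately have "odd (card (F1 \<union> F' \<union> F4)) \<longleftrightarrow> c u \<noteq> c v"
    using consistent_earsD[OF cons] P(6) by blast
  moreover have "card (F1 \<union> F' \<union> F4) = card (F1 \<union> F') + card F4"
    using int2 by (intro card_arc_append[OF a1 s(2)]) auto
  moreover have "card (F1 \<union> F') = card F1 + card F'"
    using int1 by (intro card_arc_append[OF P(1) Q(1)]) auto
  moreover have "odd (card F1) \<longleftrightarrow> c' u \<noteq> c' p" using c' by (intro arc_parity[OF P(1)]) auto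
  moreover have "odd (card F4) \<longleftrightarrow> c' q \<noteq> c' v" using c' s by (intro arc_parity[OF s(2)]) auto
  ultimately show ?thesis using c'(2)[OF uS(1)] c'(2)[OF uS(2)] by auto
qed

lemma consistent_ears_extend:
  assumes cons: "consistent_ears en E S c"
    and P: "arc en u F W v" "u \<noteq> v" "W \<inter> S = {u, v}" "F \<subseteq> E"
    and c': "\<And>e. e \<in> F \<Longrightarrow> bichromatic en c' e" "\<And>x. x \<in> S \<Longrightarrow> c' x = c x"
  shows "consistent_ears en E (S \<union> W) c'"
\<comment> \<open>Since \<open>u\<close> and \<open>v\<close> differ, \<open>p\<close> differs from
  at least one of them; reversing the old ear reduces the case \<open>p = v\<close> to the other
  one.\<close>
proof -
  have one: "odd (card F') \<longleftrightarrow> c' p \<noteq> c' q"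
    if Q: "arc en p F' W' q" "W' \<inter> (S \<union> W) = {p, q}" "F' \<subseteq> E" "p \<in> S" "q \<notin> S" "q \<in> W"
    for p q F' W'
  proof (cases "p = v")
    case False
    then show ?thesis by (intro consistent_ears_extend_one_side[OF cons P c' Q]) auto
  next
    case True
    then have "p \<noteq> u" using P by auto
    moreover have "W \<inter> S = {v, u}" using P by auto
    ultimately show ?thesis
      using consistent_ears_extend_one_side[OF cons arc_reverse[OF P(1)] P(2)[symmetric] _ P(4) c' Q]
      by auto
  qed
  show ?thesis
    unfolding consistent_ears_def
  proof (intro allI impI)
    fix p q F' W'
    assume Q: "arc en p F' W' q" "p \<noteq> q" "W' \<inter> (S \<union> W) = {p, q}" "F' \<subseteq> E"
    have Q': "arc en q F' W' p" "W' \<inter> (S \<union> W) = {q, p}" using arc_reverse[OF Q(1)] Q(3) by auto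
    consider "p \<in> S" "q \<in> S" | "p \<in> S" "q \<notin> S" | "q \<in> S" "p \<notin> S" | "p \<notin> S" "q \<notin> S" by blast
    then show "odd (card F') \<longleftrightarrow> c' p \<noteq> c' q"
    proof cases
      case 1
      then have "W' \<inter> S = {p, q}" using Q(3) by auto
      then have "odd (card F') \<longleftrightarrow> c p \<noteq> c q" using consistent_earsD[OF cons Q(1,2) _ Q(4)] by auto
      then show ?thesis using c' 1 by auto
    next
      case 2
      then have "q \<in> W" using Q(3) by auto
      then show ?thesis using one[OF Q(1,3,4)] 2 by auto
    next
      case 3
      then have "p \<in> W" using Q(3) by auto
      then show ?thesis using one[OF Q' Q(4)] 3 by auto
    next
      case 4
      then have "p \<in> W" "q \<in> W" using Q(3) by auto
      then obtain F1 W1 F2 W2 where s: "arc en u F1 W1 p" "arc en p F2 W2 v" "W1 \<inter> W2 = {p}"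
          "F1 \<union> F2 = F" "W1 \<union> W2 = W"
        using arc_split[OF P(1), of p] by blast
      show ?thesis
      proof (cases "q \<in> W2")
        case True
        show ?thesis
          by (rule consistent_ears_extend_two_sides[OF cons s(1,2,3)])
            (use s P Q 4 True c' in auto)
      next
        case False
        then have "q \<in> W1" using s \<open>q \<in> W\<close> by auto
        \<comment> \<open>Now \<open>q\<close> comes before \<open>p\<close> on the old ear, so the
          ear is traversed from \<open>v\<close> to \<open>u\<close>.\<close>
        have "W2 \<inter> W1 = {p}" "(W2 \<union> W1) \<inter> S = {v, u}" "F2 \<union> F1 \<subseteq> E"
          "W' \<inter> (S \<union> (W2 \<union> W1)) = {p, q}"
          using s P Q(3) by (auto simp: Un_commute)
        moreover have "bichromatic en c' e" if "e \<in> F2 \<union> F1" for e using c'(1) s(4) that by blast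
        ultimately show ?thesis
          using consistent_ears_extend_two_sides[OF cons arc_reverse[OF s(2)] arc_reverse[OF s(1)]
              _ _ _ P(2)[symmetric] _ c'(2) Q(1) _ Q(4) 4 \<open>q \<in> W1\<close> Q(2)] by blast
      qed
    qed
  qed
qed

text \<open>Induction on the number of vertices outside \<open>S\<close>, extending the colouring
  along one ear at a time. Once \<open>S\<close> contains all vertices, each edge of
  \<open>E\<close> is an ear of length one, and consistency makes it bichromatic.\<close>

lemma consistent_ears_colouring:
  assumes G: "multigraph G" "two_connected G"
    and S: "S \<subseteq> verts G" "a \<in> S" "b \<in> S" "a \<noteq> b"
    and E: "E \<subseteq> edges G" "\<And>e. e \<in> edges G - E \<Longrightarrow> ends G e \<subseteq> S"
    and cons: "consistent_ears (ends G) E S c"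
  shows "\<exists>c'. (\<forall>x\<in>S. c' x = c x) \<and> (\<forall>e\<in>E. bichromatic (ends G) c' e)"
  using S E(2) cons
proof (induction "card (verts G - S)" arbitrary: S c rule: less_induct)
  case less
  note S = less.prems(1-4) and E2 = less.prems(5) and cons = less.prems(6)
  have two: "card (ends G e) = 2" if "e \<in> E" for e using G(1) E(1) that by (auto simp: multigraph_def)
  show ?case
  proof (cases "S = verts G")
    case True
    have "bichromatic (ends G) c e" if e: "e \<in> E" for e
      unfolding bichromatic_def
    proof (intro allI impI)
      fix x y
      assume xy: "ends G e = {x, y}"
      then have "x \<noteq> y" using two[OF e] by auto
      moreover have "ends G e \<subseteq> verts G" using e E(1) G(1) by (auto simp: multigraph_def)
      then have "{x, y} \<inter> S = {x, y}" using xy True by auto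
      ultimately have "odd (card {e}) \<longleftrightarrow> c x \<noteq> c y"
        using consistent_earsD[OF cons arc_single[of "ends G" e x y, OF xy]] e by auto
      then show "c x \<noteq> c y" by simp
    qed
    then show ?thesis by blast
  next
    case False
    then obtain u v F W where P: "arc (ends G) u F W v" "u \<noteq> v" "W \<inter> S = {u, v}"
        "F \<subseteq> edges G" "\<not> W \<subseteq> S"
      using ear_exists[OF G, of S a b] S by blast
    \<comment> \<open>An edge of the ear outside \<open>E\<close> has both ends in \<open>S\<close>,
      so it joins \<open>u\<close> and \<open>v\<close>. The ear would then be this single edge and
      contain no new vertex.\<close>
    have FE: "F \<subseteq> E"
    proof
      fix e assume e: "e \<in> F"
      show "e \<in> E"
      proof (rule ccontr)
        assume "e \<notin> E"
        then have "ends G e \<subseteq> {u, v}" using E2[of e] e P(3,4) arc_ends_subset[OF P(1) e] by auto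
        moreover have "card (ends G e) = 2" using G(1) P(4) e by (auto simp: multigraph_def)
        ultimately have "ends G e = {u, v}" using P(2) by (intro card_subset_eq) auto
        then have "W = {u, v}" using arc_edge_joining_ends[OF P(1) e] by simp
        then show False using P by auto
      qed
    qed
    obtain c1 where c1: "c1 u = c u" "\<And>e. e \<in> F \<Longrightarrow> bichromatic (ends G) c1 e"
      using arc_colouring_exists[OF P(1)] by metis
    \<comment> \<open>Both colourings agree at \<open>u\<close>, and for both the parity of the ear
      tells whether the colours of \<open>u\<close> and \<open>v\<close> differ. So they can be
      glued.\<close>
    have "c1 v = c v"
      using arc_parity[OF P(1) c1(2)] consistent_earsD[OF cons P(1-3) FE] c1(1) by auto
    define c' where "c' = (\<lambda>x. if x \<in> W then c1 x else c x)"
    have c'S: "c' x = c x" if "x \<in> S" for x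
      using that P(3) c1(1) \<open>c1 v = c v\<close> unfolding c'_def by auto
    have c'F: "bichromatic (ends G) c' e" if e: "e \<in> F" for e
      using c1(2)[OF e] arc_ends_subset[OF P(1) e] unfolding bichromatic_def c'_def by auto
    have cons': "consistent_ears (ends G) E (S \<union> W) c'"
      by (rule consistent_ears_extend[OF cons P(1-3) FE c'F c'S])
    have W: "W \<subseteq> verts G" using arc_verts_subset[OF G(1) P(1,2,4)] .
    have "verts G - (S \<union> W) \<subset> verts G - S" using W P(5) by auto
    then have "card (verts G - (S \<union> W)) < card (verts G - S)"
      using G(1) by (intro psubset_card_mono) (auto simp: multigraph_def)
    then obtain c'' where c'': "\<forall>x\<in>S \<union> W. c'' x = c' x" "\<forall>e\<in>E. bichromatic (ends G) c'' e"
      using less.hyps[of "S \<union> W" c'] W S E2 cons' by blast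
    then show ?thesis using c'S by auto
  qed
qed

section \<open>Circuits\<close>

text \<open>Disjointness of the edge sets excludes the case that both arcs are the same single edge;
  two parallel edges do form a circuit.\<close>

lemma arcs_circuit_graph:
  assumes A: "arc en u A WA v" and B: "arc en u B WB v" and uv: "u \<noteq> v"
    and W: "WA \<inter> WB = {u, v}" and AB: "A \<inter> B = {}"
  shows "circuit_graph \<lparr>verts = WA \<union> WB, edges = A \<union> B, ends = en\<rparr>" (is "circuit_graph ?C")
proof -
  have fin: "finite A" "finite WA" "finite B" "finite WB" using arc_finite A B by metis+
  have "multigraph ?C"
    using fin arc_ends_subset[OF A] arc_ends_subset[OF B] arc_card_ends[OF A] arc_card_ends[OF B]
    by (auto simp: multigraph_def)
  moreover have "degree ?C x = 2" if x: "x \<in> WA \<union> WB" for x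
  proof -
    have "{e \<in> A \<union> B. x \<in> en e} = {e \<in> A. x \<in> en e} \<union> {e \<in> B. x \<in> en e}" by auto
    then have "degree ?C x = card {e \<in> A. x \<in> en e} + card {e \<in> B. x \<in> en e}"
      using fin AB unfolding degree_def by (simp add: card_Un_disjoint disjoint_iff)
    then show ?thesis using arc_degree[OF A uv, of x] arc_degree[OF B uv, of x] W x by (auto split: if_splits)
  qed
  moreover have "connected_graph ?C"
  proof -
    have "(u, x) \<in> (adj en (A \<union> B))\<^sup>*" if "x \<in> WA \<union> WB" for x
    proof -
      have "(adj en A)\<^sup>* \<subseteq> (adj en (A \<union> B))\<^sup>*" "(adj en B)\<^sup>* \<subseteq> (adj en (A \<union> B))\<^sup>*"
        by (intro rtrancl_mono adj_mono; simp)+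
      then show ?thesis using that arc_reaches[OF A, of x] arc_reaches[OF B, of x] by auto
    qed
    then have "(x, y) \<in> (adj en (A \<union> B))\<^sup>*" if "x \<in> WA \<union> WB" "y \<in> WA \<union> WB" for x y
      using that sym_adj_rtrancl[of en "A \<union> B"] by (meson rtrancl_trans symD)
    then show ?thesis using arc_endpoints[OF A] by (auto simp: connected_graph_def adjacency_eq_adj)
  qed
  ultimately show ?thesis by (simp add: circuit_graph_def)
qed

lemma arcs_circuit:
  assumes "multigraph G" "arc (ends G) u A WA v" "arc (ends G) u B WB v" "u \<noteq> v"
    "WA \<inter> WB = {u, v}" "A \<inter> B = {}" "A \<union> B \<subseteq> edges G"
  shows "A \<union> B \<in> circuits G"
proof -
  let ?C = "\<lparr>verts = WA \<union> WB, edges = A \<union> B, ends = ends G\<rparr>"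
  have C: "circuit_graph ?C" using arcs_circuit_graph assms by metis
  moreover have "subgraph ?C G"
    using C arc_verts_subset[OF assms(1,2,4)] arc_verts_subset[OF assms(1,3,4)] assms(7)
    by (auto simp: subgraph_def circuit_graph_def)
  ultimately show ?thesis unfolding circuits_def by force
qed

text \<open>Remove the edges of any arc \<open>A\<close> from \<open>u\<close> to \<open>v\<close>.
  Then \<open>u\<close> and \<open>v\<close> have degree one and all other degrees are even, so the
  handshake argument yields a second arc \<open>B\<close>. As all degrees in a circuit are two,
  \<open>B\<close> avoids the inner vertices of \<open>A\<close>, and connectedness leaves nothing
  outside the two arcs.\<close>

lemma circuit_split:
  assumes C: "circuit_graph C" and u: "u \<in> verts C" and v: "v \<in> verts C" and uv: "u \<noteq> v"
  obtains A WA B WB where "arc (ends C) u A WA v" "arc (ends C) u B WB v" "WA \<inter> WB = {u, v}"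
    "A \<inter> B = {}" "A \<union> B = edges C" "WA \<union> WB = verts C"
proof -
  let ?E = "edges C" and ?en = "ends C"
  have mg: "multigraph C" using C by (simp add: circuit_graph_def)
  have deg: "card {e \<in> ?E. x \<in> ?en e} = 2" if "x \<in> verts C" for x
    using C that by (auto simp: circuit_graph_def degree_def)
  have fin: "finite ?E" using mg by (simp add: multigraph_def)
  have reach: "(x, y) \<in> (adj ?en ?E)\<^sup>*" if "x \<in> verts C" "y \<in> verts C" for x y
    using C that by (auto simp: circuit_graph_def connected_graph_def adjacency_eq_adj)
  obtain A WA where A: "arc ?en u A WA v" "A \<subseteq> ?E" using reaches_imp_arc[OF reach[OF u v]] by blast
  have WA: "WA \<subseteq> verts C" using arc_verts_subset[OF mg A(1) uv A(2)] .
  have degR: "card {e \<in> ?E - A. x \<in> ?en e} = card {e \<in> ?E. x \<in> ?en e} - card {e \<in> A. x \<in> ?en e}" for x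
  proof -
    have "{e \<in> ?E - A. x \<in> ?en e} = {e \<in> ?E. x \<in> ?en e} - {e \<in> A. x \<in> ?en e}" by auto
    then show ?thesis using A(2) fin by (simp add: card_Diff_subset Collect_mono_iff finite_subset subset_iff)
  qed
  have deg0: "card {e \<in> ?E. x \<in> ?en e} = 0" if "x \<notin> verts C" for x
    using that mg by (auto simp: multigraph_def card_eq_0_iff)
  have degA: "card {e \<in> A. x \<in> ?en e} = (if x \<notin> WA then 0 else if x = u \<or> x = v then 1 else 2)" for x
    using arc_degree[OF A(1) uv] .
  have "u \<in> WA" "v \<in> WA" using arc_endpoints[OF A(1)] by auto
  have uvR: "(u, v) \<in> (adj ?en (?E - A))\<^sup>*"
  proof (rule reaches_other_odd_vertex)
    show "finite (?E - A)" using fin by simp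
    show "card (?en e) = 2" if "e \<in> ?E - A" for e using that mg by (auto simp: multigraph_def)
    show "odd (card {e \<in> ?E - A. u \<in> ?en e})"
      unfolding degR degA using deg[OF u] \<open>u \<in> WA\<close> by simp
    show "even (card {e \<in> ?E - A. x \<in> ?en e})" if "x \<noteq> u" "x \<noteq> v" for x
      unfolding degR degA using deg[of x] deg0[of x] that by (cases "x \<in> verts C") auto
  qed
  obtain B WB where B: "arc ?en u B WB v" "B \<subseteq> ?E - A" using reaches_imp_arc[OF uvR] by blast
  have WB: "WB \<subseteq> verts C" using arc_verts_subset[OF mg B(1) uv] B(2) by auto
  have uvB: "u \<in> WB" "v \<in> WB" using arc_endpoints[OF B(1)] by auto
  have "x = u \<or> x = v" if x: "x \<in> WA" "x \<in> WB" for x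
  proof (rule ccontr)
    assume "\<not> (x = u \<or> x = v)"
    then have "card {e \<in> ?E - A. x \<in> ?en e} = 0"
      unfolding degR degA using x WA deg[of x] by auto
    then have "{e \<in> ?E - A. x \<in> ?en e} = {}" using fin by simp
    moreover have "x \<in> (\<Union>e\<in>B. ?en e)" using x arc_verts[OF B(1) uv] by simp
    ultimately show False using B(2) by auto
  qed
  then have W: "WA \<inter> WB = {u, v}" using \<open>u \<in> WA\<close> \<open>v \<in> WA\<close> uvB by auto
  have AB: "A \<inter> B = {}" using B(2) by auto
  have "circuit_graph \<lparr>verts = WA \<union> WB, edges = A \<union> B, ends = ?en\<rparr>"
    using arcs_circuit_graph[OF A(1) B(1) uv W AB] .
  then have degAB: "card {e \<in> A \<union> B. x \<in> ?en e} = 2" if "x \<in> WA \<union> WB" for x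
    using that by (auto simp: circuit_graph_def degree_def)
  \<comment> \<open>At each of its vertices the union of the two arcs already has degree two, so no
    other edge of the circuit is attached there.\<close>
  have closed: "e \<in> A \<union> B" if "e \<in> ?E" "x \<in> ?en e" "x \<in> WA \<union> WB" for e x
  proof -
    have "x \<in> verts C" using that(3) WA WB by auto
    have "{e \<in> A \<union> B. x \<in> ?en e} = {e \<in> ?E. x \<in> ?en e}"
      using fin A(2) B(2) degAB[OF that(3)] deg[OF \<open>x \<in> verts C\<close>]
      by (intro card_subset_eq) auto
    then show ?thesis using that by auto
  qed
  have "x \<in> WA \<union> WB" if "(u, x) \<in> (adj ?en ?E)\<^sup>*" for x
    using that
  proof (induction rule: rtrancl_induct)
    case base
    then show ?case using \<open>u \<in> WA\<close> by auto
  next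
    case (step y z)
    then obtain e where e: "e \<in> ?E" "?en e = {y, z}" by (auto simp: adj_def)
    then have "e \<in> A \<union> B" using closed[of e y] step.IH by auto
    then show ?case using arc_ends_subset[OF A(1), of e] arc_ends_subset[OF B(1), of e] e(2) by auto
  qed
  then have V: "WA \<union> WB = verts C" using reach[OF u] WA WB by auto
  have "e \<in> A \<union> B" if e: "e \<in> ?E" for e
  proof -
    obtain x y where "?en e = {x, y}" "x \<in> verts C" using multigraph_edge[OF mg e] by metis
    then show ?thesis using closed[OF e, of x] V by auto
  qed
  then have "A \<union> B = ?E" using A(2) B(2) by auto
  then show thesis using that[OF A(1) B(1) W AB _ V] by blast
qed

lemma circuit_two_verts:
  assumes "circuit_graph C"
  obtains a b where "a \<in> verts C" "b \<in> verts C" "a \<noteq> b"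
proof -
  obtain x where x: "x \<in> verts C" using assms by (auto simp: circuit_graph_def connected_graph_def)
  then have "card {e \<in> edges C. x \<in> ends C e} = 2" using assms by (auto simp: circuit_graph_def degree_def)
  then have "{e \<in> edges C. x \<in> ends C e} \<noteq> {}" by (metis card.empty zero_neq_numeral)
  then obtain e where "e \<in> edges C" by blast
  then show thesis using multigraph_edge that assms by (metis circuit_graph_def)
qed

lemma circuit_obtain:
  assumes "D \<in> circuits G"
  obtains C where "circuit_graph C" "edges C = D" "verts C \<subseteq> verts G" "D \<subseteq> edges G"
    "\<And>e. e \<in> D \<Longrightarrow> ends C e = ends G e" "\<And>e. e \<in> D \<Longrightarrow> ends G e \<subseteq> verts C"
proof -
  obtain C where C: "D = edges C" "subgraph C G" "circuit_graph C" using assms by (auto simp: circuits_def)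
  then show thesis
    using that[of C] by (auto simp: subgraph_def multigraph_def)
qed

lemma circuit_split_in:
  assumes "circuit_graph C" "\<And>e. e \<in> edges C \<Longrightarrow> ends C e = ends G e"
    "u \<in> verts C" "v \<in> verts C" "u \<noteq> v"
  obtains A WA B WB where "arc (ends G) u A WA v" "arc (ends G) u B WB v" "WA \<inter> WB = {u, v}"
    "A \<inter> B = {}" "A \<union> B = edges C" "WA \<union> WB = verts C"
proof -
  obtain A WA B WB where s: "arc (ends C) u A WA v" "arc (ends C) u B WB v" "WA \<inter> WB = {u, v}"
    "A \<inter> B = {}" "A \<union> B = edges C" "WA \<union> WB = verts C"
    using circuit_split[OF assms(1,3-5)] by blast
  have "arc (ends G) u A WA v" "arc (ends G) u B WB v"
    using arc_cong[OF s(1), of "ends G"] arc_cong[OF s(2), of "ends G"] s(5) assms(2) by auto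
  then show thesis using s that by blast
qed

lemma circuit_even_degree:
  assumes "D \<in> circuits G"
  shows "even (card {e \<in> D. x \<in> ends G e})"
proof -
  obtain C where C: "circuit_graph C" "edges C = D" "\<And>e. e \<in> D \<Longrightarrow> ends C e = ends G e"
    using circuit_obtain[OF assms] by metis
  have "{e \<in> D. x \<in> ends G e} = {e \<in> edges C. x \<in> ends C e}" using C by auto
  moreover have "{e \<in> edges C. x \<in> ends C e} = {}" if "x \<notin> verts C"
    using that C(1) by (auto simp: circuit_graph_def multigraph_def)
  moreover have "card {e \<in> edges C. x \<in> ends C e} = 2" if "x \<in> verts C"
    using that C(1) by (auto simp: circuit_graph_def degree_def)
  ultimately show ?thesis by (metis card.empty even_numeral even_zero)
qed

text \<open>Both arcs between \<open>u\<close> and \<open>v\<close> are coloured alternately,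
  starting with the same colour at \<open>u\<close>. Their lengths have equal parity, so the
  colourings agree at \<open>v\<close> as well.\<close>

lemma even_circuit_colouring:
  assumes C: "circuit_graph C" and even: "even (card (edges C))"
  shows "\<exists>c. \<forall>e\<in>edges C. bichromatic (ends C) c e"
proof -
  obtain u v where uv: "u \<in> verts C" "v \<in> verts C" "u \<noteq> v" using circuit_two_verts[OF C] .
  obtain A WA B WB where s: "arc (ends C) u A WA v" "arc (ends C) u B WB v" "WA \<inter> WB = {u, v}"
    "A \<inter> B = {}" "A \<union> B = edges C"
    using circuit_split[OF C uv] by metis
  obtain c1 where c1: "c1 u = True" "\<And>e. e \<in> A \<Longrightarrow> bichromatic (ends C) c1 e"
    using arc_colouring_exists[OF s(1)] by metis
  obtain c2 where c2: "c2 u = True" "\<And>e. e \<in> B \<Longrightarrow> bichromatic (ends C) c2 e"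
    using arc_colouring_exists[OF s(2)] by metis
  have "card (edges C) = card A + card B"
    using s(4,5) arc_finite[OF s(1)] arc_finite[OF s(2)] by (metis card_Un_disjoint)
  then have "c1 v = c2 v"
    using even arc_parity[OF s(1) c1(2)] arc_parity[OF s(2) c2(2)] c1(1) c2(1) by auto
  define c where "c = (\<lambda>x. if x \<in> WA then c1 x else c2 x)"
  have cB: "c x = c2 x" if "x \<in> WB" for x
    using that s(3) c1(1) c2(1) \<open>c1 v = c2 v\<close> unfolding c_def by auto
  have "bichromatic (ends C) c e" if e: "e \<in> A" for e
    using c1(2)[OF e] arc_ends_subset[OF s(1) e] unfolding bichromatic_def c_def by auto
  moreover have "bichromatic (ends C) c e" if e: "e \<in> B" for e
    using c2(2)[OF e] arc_ends_subset[OF s(2) e] cB unfolding bichromatic_def by auto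
  ultimately show ?thesis using s(5) by blast
qed

section \<open>Theta graphs and odd subdivisions\<close>

text \<open>The missing edge \<open>None\<close> is itself an arc between the same ends, and the two
  arcs close up to a circuit.\<close>

lemma arc_path_joining:
  assumes "arc en u F W v" "u \<noteq> v"
  shows "path_joining {u, v} \<lparr>verts = W, edges = F, ends = en\<rparr>"
proof -
  let ?en = "case_option {u, v} en"
  \<comment> \<open>The ends of \<open>None\<close> are kept as an arbitrary \<open>D\<close>
    because \<open>u\<close> changes during the induction while the map of ends must stay
    fixed.\<close>
  have "arc (case_option D en) u (Some ` F) W v" for D
    using assms(1) by (induction rule: arc.induct) (auto intro: arc.intros)
  moreover have "arc ?en u {None} {u, v} v" using assms(2) by (intro arc_single) auto
  ultimately have "circuit_graph \<lparr>verts = W \<union> {u, v}, edges = Some ` F \<union> {None}, ends = ?en\<rparr>"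
    using assms arc_endpoints[OF assms(1)] by (intro arcs_circuit_graph) auto
  moreover have "W \<union> {u, v} = W" using arc_endpoints[OF assms(1)] by auto
  ultimately show ?thesis by (simp add: path_joining_def add_new_edge_def)
qed

lemma arc_subgraph:
  assumes "multigraph G" "arc (ends G) u F W v" "W \<subseteq> verts G" "F \<subseteq> edges G"
  shows "subgraph \<lparr>verts = W, edges = F, ends = ends G\<rparr> G"
  using assms arc_finite[OF assms(2)] arc_ends_subset[OF assms(2)] arc_card_ends[OF assms(2)]
  by (auto simp: subgraph_def multigraph_def)

text \<open>The even arc \<open>B\<close> is cut after its first edge \<open>b\<close>, at a vertex
  \<open>w\<close>. The edge \<open>b\<close> and the odd rest replace the two simple edges of the
  triangle, and \<open>A\<close> and \<open>P\<close> replace the doubled one.\<close>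

lemma theta_not_free:
  assumes G: "multigraph G" and uv: "u \<noteq> v"
    and A: "arc (ends G) u A WA v" "A \<subseteq> edges G" "odd (card A)"
    and B: "arc (ends G) u B WB v" "B \<subseteq> edges G" "even (card B)"
    and P: "arc (ends G) u P WP v" "P \<subseteq> edges G" "odd (card P)"
    and W: "WA \<inter> WB = {u, v}" "WA \<inter> WP = {u, v}" "WB \<inter> WP = {u, v}"
    and E: "A \<inter> B = {}" "A \<inter> P = {}" "B \<inter> P = {}"
  shows "\<not> odd_C3_plus_free G"
proof -
  obtain b w B' WB' where b: "B = insert b B'" "WB = insert u WB'" "ends G b = {u, w}"
      "arc (ends G) w B' WB' v" "u \<notin> WB'"
    using B(1) uv by (cases rule: arc.cases) auto
  have wW: "w \<in> WB'" "v \<in> WB'" using arc_endpoints[OF b(4)] by auto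
  have uw: "u \<noteq> w" using wW b(5) by auto
  have bB': "b \<notin> B'" using arc_ends_subset[OF b(4), of b] b(3,5) by auto
  \<comment> \<open>The rest is odd and therefore not empty, so \<open>w\<close> differs from
    \<open>v\<close> and is a genuine third vertex.\<close>
  then have oddB': "odd (card B')" using B(3) b(1) arc_finite[OF b(4)] by auto
  then have wv: "w \<noteq> v" using arc_trivial[of "ends G" v B' WB'] b(4) by auto
  have wA: "w \<notin> WA" "w \<notin> WP" using W wW b(2) uw wv by auto
  have ab: "arc (ends G) u {b} {u, w} w" using b(3) uw by (rule arc_single)
  have VA: "WA \<subseteq> verts G" "WB \<subseteq> verts G" "WP \<subseteq> verts G"
    using arc_verts_subset[OF G A(1) uv A(2)] arc_verts_subset[OF G B(1) uv B(2)]
      arc_verts_subset[OF G P(1) uv P(2)] .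
  \<comment> \<open>The numbering follows \<open>C3_plus\<close>: its edges 0 and 1 meet in the
    vertex 1, and its edges 2 and 3 are parallel and join 0 and 2.\<close>
  define \<phi> where "\<phi> = (\<lambda>i::nat. if i = 0 then u else if i = 1 then w else v)"
  define mk where "mk = (\<lambda>F W. \<lparr>verts = W, edges = F, ends = ends G\<rparr>)"
  define Q where "Q = (\<lambda>i::nat. if i = 0 then mk {b} {u, w} else if i = 1 then mk B' WB'
    else if i = 2 then mk A WA else mk P WP)"
  define S where "S = mk (A \<union> B \<union> P) (WA \<union> WB \<union> WP)"
  have "ends G e \<subseteq> WA \<union> WB \<union> WP" if "e \<in> A \<union> B \<union> P" for e
    using that arc_ends_subset[OF A(1), of e] arc_ends_subset[OF B(1), of e]
      arc_ends_subset[OF P(1), of e] by auto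
  then have S: "subgraph S G"
    using VA A(2) B(2) P(2) G arc_finite[OF A(1)] arc_finite[OF B(1)] arc_finite[OF P(1)]
    by (auto simp: S_def mk_def subgraph_def multigraph_def)
  then have mS: "multigraph S" by (simp add: subgraph_def)
  have sub: "subgraph (mk F W) S"
    if "arc (ends G) x F W y" "F \<subseteq> A \<union> B \<union> P" "W \<subseteq> WA \<union> WB \<union> WP" for x y F W
    using arc_subgraph[OF mS, of x F W y] that by (simp add: S_def mk_def)
  have subs: "subgraph (mk {b} {u, w}) S" "subgraph (mk B' WB') S" "subgraph (mk A WA) S" "subgraph (mk P WP) S"
    using sub[OF ab] sub[OF b(4)] sub[OF A(1)] sub[OF P(1)] b(1,2) wW by auto
  have pjs: "path_joining {u, w} (mk {b} {u, w})" "path_joining {w, v} (mk B' WB')"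
    "path_joining {u, v} (mk A WA)" "path_joining {u, v} (mk P WP)"
    using arc_path_joining[OF ab uw] arc_path_joining[OF b(4) wv] arc_path_joining[OF A(1) uv]
      arc_path_joining[OF P(1) uv] by (simp_all add: mk_def)
  have 1: "inj_on \<phi> (verts C3_plus)"
    using uv uw wv by (auto simp: \<phi>_def C3_plus_def inj_on_def)
  have int: "WA \<inter> WB' = {v}" "WP \<inter> WB' = {v}" using W b(2,5) wW by auto
  have uvW: "u \<in> WA" "v \<in> WA" "u \<in> WP" "v \<in> WP" using W by auto
  have 2: "\<forall>e\<in>edges C3_plus. subgraph (Q e) S \<and> path_joining (\<phi> ` ends C3_plus e) (Q e) \<and>
           odd (card (edges (Q e))) \<and> (verts (Q e) - \<phi> ` ends C3_plus e) \<inter> \<phi> ` verts C3_plus = {}"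
    using subs pjs A(3) P(3) oddB' wA b(5)
    by (simp add: C3_plus_def Q_def \<phi>_def) (auto simp: mk_def insert_commute)
  have 3: "\<forall>e\<in>edges C3_plus. \<forall>f\<in>edges C3_plus. e \<noteq> f \<longrightarrow>
           edges (Q e) \<inter> edges (Q f) = {} \<and>
           (verts (Q e) - \<phi> ` ends C3_plus e) \<inter> (verts (Q f) - \<phi> ` ends C3_plus f) = {}"
  proof -
    have "x = v" if "x \<in> WB'" "x \<in> WA \<or> x \<in> WP" for x using int that by blast
    moreover have "x = u \<or> x = v" if "x \<in> WA" "x \<in> WP" for x using W(2) that by blast
    moreover have "e \<notin> B'" "e \<noteq> b" if "e \<in> A \<or> e \<in> P" for e using E b(1) that by blast+
    moreover have "e \<notin> A" if "e \<in> P" for e using E that by blast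
    ultimately show ?thesis using bB' by (simp add: C3_plus_def Q_def \<phi>_def mk_def) auto
  qed
  have 4: "verts S = \<phi> ` verts C3_plus \<union> (\<Union>e\<in>edges C3_plus. verts (Q e))"
    using uvW wW b(2) by (simp add: S_def C3_plus_def Q_def \<phi>_def mk_def) blast
  have 5: "edges S = (\<Union>e\<in>edges C3_plus. edges (Q e))"
    using b(1) by (simp add: S_def C3_plus_def Q_def \<phi>_def mk_def) blast
  have "totally_odd_subdivision C3_plus S"
    unfolding totally_odd_subdivision_def using mS 1 2 3 4 5 by blast
  then show ?thesis using S by (auto simp: odd_C3_plus_free_def)
qed

section \<open>The cycle space\<close>

lemma incidence_vector_sym_diff:
  "incidence_vector A + incidence_vector B = incidence_vector ((A - B) \<union> (B - A))"
  by (auto simp: incidence_vector_def fun_eq_iff)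

lemma incidence_vector_disjoint_Un:
  "A \<inter> B = {} \<Longrightarrow> incidence_vector (A \<union> B) = incidence_vector A + incidence_vector B"
  by (auto simp: incidence_vector_def fun_eq_iff)

lemma incidence_vector_empty: "incidence_vector {} = 0"
  by (auto simp: incidence_vector_def fun_eq_iff)

lemma of_nat_bit: "(of_nat n :: bit) = of_bool (odd n)"
  by (induction n) auto

lemma sum_incidence_vector:
  assumes "finite E" "C \<subseteq> E"
  shows "(\<Sum>e\<in>E. incidence_vector C e) = of_bool (odd (card C))"
proof -
  have "(\<Sum>e\<in>E. incidence_vector C e) = (\<Sum>e\<in>C. 1)"
    using assms unfolding incidence_vector_def by (intro sum.mono_neutral_cong_right) auto
  then show ?thesis by (simp add: of_nat_bit)
qed

lemma sum_incidence_vector_mult: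
  assumes "finite E" "C \<subseteq> E"
  shows "(\<Sum>e\<in>E. incidence_vector C e * incidence_vector D e) = of_bool (odd (card (C \<inter> D)))"
proof -
  have "incidence_vector C e * incidence_vector D e = incidence_vector (C \<inter> D) e" for e
    by (auto simp: incidence_vector_def)
  moreover have "C \<inter> D \<subseteq> E" using assms(2) by auto
  ultimately show ?thesis
    using sum_incidence_vector[OF assms(1), of "C \<inter> D"] by (simp del: mult_bit_eq_and)
qed

text \<open>For incidence vectors the identity reads
  \<open>|C \<inter> D| \<equiv> |C| \<cdot> |D|\<close> modulo 2. Both sides are bilinear, so for
  fixed \<open>y\<close> the solutions \<open>x\<close> form a subspace; the identity is extended
  from \<open>X\<close> to its span in one argument and then in the other.\<close>

lemma rank_one_form_span:
  fixes E :: "'e set" and X :: "('e \<Rightarrow> bit) set"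
  assumes X: "\<And>x y. x \<in> X \<Longrightarrow> y \<in> X \<Longrightarrow> (\<Sum>e\<in>E. x e * y e) = sum x E * sum y E"
    and xy: "x \<in> F2.span X" "y \<in> F2.span X"
  shows "(\<Sum>e\<in>E. x e * y e) = sum x E * sum y E"
proof -
  have sub: "F2.subspace {x. (\<Sum>e\<in>E. x e * y e) = sum x E * sum y E}" for y :: "'e \<Rightarrow> bit"
    unfolding F2.subspace_def
    by (simp add: F2_scale_def distrib_right sum.distrib mult.assoc sum_distrib_left[symmetric]
        del: add_bit_eq_xor mult_bit_eq_and)
  have 1: "(\<Sum>e\<in>E. x e * y e) = sum x E * sum y E" if "y \<in> X" "x \<in> F2.span X" for x y
    using F2.span_minimal[OF _ sub, of X y] X that by blast
  have "(\<Sum>e\<in>E. y e * x e) = sum y E * sum x E" if "y \<in> X" for y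
    using 1[OF that xy(1)] by (simp add: mult.commute del: mult_bit_eq_and)
  then have "X \<subseteq> {y. (\<Sum>e\<in>E. y e * x e) = sum y E * sum x E}" by blast
  then have "(\<Sum>e\<in>E. y e * x e) = sum y E * sum x E"
    using F2.span_minimal[OF _ sub] xy(2) by blast
  then show ?thesis by (simp add: mult.commute del: mult_bit_eq_and)
qed

lemma circuits_subset_cycles: "circuits G \<subseteq> cycles G"
proof
  fix C assume "C \<in> circuits G"
  then have "{C} \<subseteq> circuits G" "disjoint {C}" by auto
  then show "C \<in> cycles G" unfolding cycles_def by force
qed

lemma circuits_subset_Pow: "circuits G \<subseteq> Pow (edges G)"
  by (auto simp: circuits_def subgraph_def)

lemma cycles_subset_Pow: "cycles G \<subseteq> Pow (edges G)"
  using circuits_subset_Pow by (fastforce simp: cycles_def)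

lemma incidence_vector_disjoint_Union:
  assumes "finite \<C>" "disjoint \<C>"
  shows "incidence_vector (\<Union>\<C>) \<in> F2.span (incidence_vector ` \<C>)"
  using assms
proof (induction rule: finite_induct)
  case empty
  show ?case by (metis Union_empty incidence_vector_empty F2.span_zero)
next
  case (insert C \<C>)
  have "disjoint \<C>" using insert.prems by (simp add: pairwise_insert)
  then have "incidence_vector (\<Union>\<C>) \<in> F2.span (incidence_vector ` insert C \<C>)"
    using insert.IH F2.span_mono[of "incidence_vector ` \<C>" "incidence_vector ` insert C \<C>"] by auto
  moreover have "incidence_vector C \<in> F2.span (incidence_vector ` insert C \<C>)"
    by (simp add: F2.span_base)
  moreover have "C \<inter> \<Union>\<C> = {}"
    using insert.prems insert.hyps by (auto simp: disjoint_def)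
  ultimately show ?case by (metis Union_insert incidence_vector_disjoint_Un F2.span_add)
qed

lemma cycle_space_eq_span_circuits:
  assumes "multigraph G"
  shows "cycle_space G = F2.span (incidence_vector ` circuits G)"
proof
  have fin: "finite (circuits G)"
    using assms circuits_subset_Pow by (metis finite_Pow_iff finite_subset multigraph_def)
  have "incidence_vector C \<in> F2.span (incidence_vector ` circuits G)" if "C \<in> cycles G" for C
    using CollectD[OF that[unfolded cycles_def]]
  proof (elim exE conjE)
    fix \<C>
    assume \<C>: "C = \<Union>\<C>" "\<C> \<subseteq> circuits G" "disjoint \<C>"
    have "incidence_vector C \<in> F2.span (incidence_vector ` \<C>)"
      using incidence_vector_disjoint_Union[OF finite_subset[OF \<C>(2) fin] \<C>(3)] \<C>(1) by simp
    then show ?thesis using F2.span_mono[OF image_mono[OF \<C>(2)]] by blast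
  qed
  then show "cycle_space G \<subseteq> F2.span (incidence_vector ` circuits G)"
    unfolding cycle_space_def by (intro F2.span_minimal) auto
  show "F2.span (incidence_vector ` circuits G) \<subseteq> cycle_space G"
    unfolding cycle_space_def by (intro F2.span_mono image_mono circuits_subset_cycles)
qed

text \<open>Deleting an edge \<open>e\<close> makes exactly its two ends odd, so an arc in the
  remaining edges joins them and closes up with \<open>e\<close> to a circuit. Removing this circuit
  keeps all degrees even, and induction applies.\<close>

lemma even_degrees_in_cycle_space:
  assumes G: "multigraph G" and F: "F \<subseteq> edges G"
    and even: "\<And>x. even (card {e \<in> F. x \<in> ends G e})"
  shows "incidence_vector F \<in> cycle_space G"
  using F even
proof (induction "card F" arbitrary: F rule: less_induct)
  case less
  have fin: "finite F" using less.prems(1) G by (metis finite_subset multigraph_def)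
  show ?case
  proof (cases "F = {}")
    case True
    then show ?thesis by (simp add: incidence_vector_empty cycle_space_def F2.span_zero)
  next
    case False
    then obtain e where e: "e \<in> F" by blast
    then obtain a b where ab: "ends G e = {a, b}" "a \<noteq> b"
      using multigraph_edge[OF G subsetD[OF less.prems(1)]] by metis
    have deg: "card {d \<in> F - {e}. x \<in> ends G d} =
        card {d \<in> F. x \<in> ends G d} - (if x = a \<or> x = b then 1 else 0)" for x
    proof -
      have "{d \<in> F - {e}. x \<in> ends G d} =
          (if x = a \<or> x = b then {d \<in> F. x \<in> ends G d} - {e} else {d \<in> F. x \<in> ends G d})"
        using ab by auto
      then show ?thesis using e ab by auto
    qed
    have "e \<in> {d \<in> F. a \<in> ends G d}" using e ab by auto
    then have "card {d \<in> F. a \<in> ends G d} > 0" using fin by (auto simp: card_gt_0_iff)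
    then have a: "odd (card {d \<in> F - {e}. a \<in> ends G d})"
      unfolding deg using less.prems(2)[of a] by auto
    have "(a, b) \<in> (adj (ends G) (F - {e}))\<^sup>*"
      by (rule reaches_other_odd_vertex)
        (use fin a deg less.prems G in \<open>auto simp: multigraph_def\<close>)
    from reaches_imp_arc[OF this] obtain A W where A: "arc (ends G) a A W b" "A \<subseteq> F - {e}" by blast
    have C: "A \<union> {e} \<in> circuits G"
    proof (rule arcs_circuit[OF G A(1) _ ab(2)])
      show "arc (ends G) a {e} {a, b} b" using ab by (rule arc_single)
      show "W \<inter> {a, b} = {a, b}" using arc_endpoints[OF A(1)] by auto
    qed (use A(2) less.prems(1) e in auto)
    let ?F = "F - (A \<union> {e})"
    have sub: "A \<union> {e} \<subseteq> F" using A(2) e by auto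
    have "card ?F < card F" using e fin by (intro psubset_card_mono) auto
    moreover have "even (card {d \<in> ?F. x \<in> ends G d})" for x
    proof -
      have "{d \<in> F. x \<in> ends G d} = {d \<in> ?F. x \<in> ends G d} \<union> {d \<in> A \<union> {e}. x \<in> ends G d}"
        using sub by auto
      also have "card \<dots> = card {d \<in> ?F. x \<in> ends G d} + card {d \<in> A \<union> {e}. x \<in> ends G d}"
        using fin finite_subset[OF sub fin] by (intro card_Un_disjoint) auto
      finally have "card {d \<in> F. x \<in> ends G d} =
          card {d \<in> ?F. x \<in> ends G d} + card {d \<in> A \<union> {e}. x \<in> ends G d}" .
      then show ?thesis using less.prems(2)[of x] circuit_even_degree[OF C, of x] by simp
    qed
    ultimately have "incidence_vector ?F \<in> cycle_space G"
      using less.hyps[of ?F] less.prems(1) by blast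
    moreover have "incidence_vector (A \<union> {e}) \<in> cycle_space G"
      unfolding cycle_space_eq_span_circuits[OF G] using C by (intro F2.span_base) auto
    moreover have "incidence_vector F = incidence_vector ?F + incidence_vector (A \<union> {e})"
    proof -
      have "?F \<union> (A \<union> {e}) = F" using sub by auto
      moreover have "?F \<inter> (A \<union> {e}) = {}" by auto
      ultimately show ?thesis using incidence_vector_disjoint_Un by metis
    qed
    ultimately show ?thesis unfolding cycle_space_def by (metis F2.span_add)
  qed
qed

section \<open>Odd circuits\<close>

lemma bichromatic_imp_bipartite:
  assumes G: "multigraph G" and c: "\<And>e. e \<in> edges G \<Longrightarrow> bichromatic (ends G) c e"
  shows "bipartite_graph G"
  unfolding bipartite_graph_def
proof (intro exI conjI ballI)
  show "{x \<in> verts G. c x} \<union> {x \<in> verts G. \<not> c x} = verts G" by auto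
  show "{x \<in> verts G. c x} \<inter> {x \<in> verts G. \<not> c x} = {}" by auto
  fix e assume e: "e \<in> edges G"
  obtain x y where xy: "ends G e = {x, y}" "x \<in> verts G" "y \<in> verts G"
    using multigraph_edge[OF G e] by metis
  then have "c x \<noteq> c y" using c[OF e] by (auto simp: bichromatic_def)
  then consider "c x" "\<not> c y" | "c y" "\<not> c x" by blast
  then show "\<exists>x\<in>{x \<in> verts G. c x}. \<exists>y\<in>{x \<in> verts G. \<not> c x}. ends G e = {x, y}"
  proof cases
    case 1
    then show ?thesis using xy by blast
  next
    case 2
    then show ?thesis using xy by (intro bexI[of _ y] bexI[of _ x]) auto
  qed
qed

text \<open>An ear of the wrong parity forms an odd circuit with each of the two arcs into which its
  ends cut \<open>D\<close>. The ear cancels in the sum of these circuits, which leaves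
  \<open>D\<close>.\<close>

lemma even_circuit_in_span_odd_circuits:
  assumes G: "multigraph G" "two_connected G" "\<not> bipartite_graph G"
    and D: "D \<in> circuits G" "even (card D)"
  shows "incidence_vector D \<in> F2.span (incidence_vector ` {C \<in> circuits G. odd (card C)})"
proof -
  obtain C where C: "circuit_graph C" "edges C = D" "verts C \<subseteq> verts G" "D \<subseteq> edges G"
      "\<And>e. e \<in> D \<Longrightarrow> ends C e = ends G e" "\<And>e. e \<in> D \<Longrightarrow> ends G e \<subseteq> verts C"
    using circuit_obtain[OF D(1)] by metis
  obtain c where "\<forall>e\<in>edges C. bichromatic (ends C) c e"
    using even_circuit_colouring[OF C(1)] C(2) D(2) by metis
  then have c: "bichromatic (ends G) c e" if "e \<in> D" for e
    using that C(2,5) by (auto simp: bichromatic_def)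
  obtain a b where ab: "a \<in> verts C" "b \<in> verts C" "a \<noteq> b" using circuit_two_verts[OF C(1)] .
  \<comment> \<open>Otherwise the proper colouring of \<open>D\<close> would extend to a proper
    2-colouring of \<open>G\<close>.\<close>
  have "\<not> consistent_ears (ends G) (edges G - D) (verts C) c"
  proof
    assume cons: "consistent_ears (ends G) (edges G - D) (verts C) c"
    have "ends G e \<subseteq> verts C" if "e \<in> edges G - (edges G - D)" for e using C(6) that by auto
    then obtain c' where c': "\<forall>x\<in>verts C. c' x = c x" "\<forall>e\<in>edges G - D. bichromatic (ends G) c' e"
      using consistent_ears_colouring[OF G(1,2) C(3) ab Diff_subset _ cons] by blast
    have "bichromatic (ends G) c' e" if "e \<in> edges G" for e
    proof (cases "e \<in> D")
      case True
      then show ?thesis using c[OF True] C(6)[OF True] c'(1) by (auto simp: bichromatic_def)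
    next
      case False
      then show ?thesis using c' that by auto
    qed
    then show False using bichromatic_imp_bipartite[OF G(1)] G(3) by blast
  qed
  then obtain u v F W where P: "arc (ends G) u F W v" "u \<noteq> v" "W \<inter> verts C = {u, v}"
      "F \<subseteq> edges G - D" "odd (card F) \<noteq> (c u \<noteq> c v)"
    unfolding consistent_ears_def by blast
  have "u \<in> verts C" "v \<in> verts C" using P(3) by auto
  then obtain A WA B WB where s: "arc (ends G) u A WA v" "arc (ends G) u B WB v" "WA \<inter> WB = {u, v}"
    "A \<inter> B = {}" "A \<union> B = D" "WA \<union> WB = verts C"
    using circuit_split_in[OF C(1), of G u v] C(2,5) P(2) by metis
  have circ: "X \<union> F \<in> circuits G \<and> odd (card (X \<union> F))"
    if X: "arc (ends G) u X WX v" "X \<subseteq> D" "WX \<subseteq> verts C" for X WX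
  proof
    have "u \<in> WX" "v \<in> WX" using arc_endpoints[OF X(1)] by auto
    then have "WX \<inter> W = {u, v}" using P(3) X(3) by auto
    moreover have disj: "X \<inter> F = {}" using X(2) P(4) by auto
    moreover have "X \<union> F \<subseteq> edges G" using X(2) C(4) P(4) by auto
    ultimately show "X \<union> F \<in> circuits G" by (rule arcs_circuit[OF G(1) X(1) P(1,2)])
    have "odd (card X) \<longleftrightarrow> c u \<noteq> c v" using c X(2) by (intro arc_parity[OF X(1)]) auto
    moreover have "card (X \<union> F) = card X + card F"
      using disj arc_finite[OF X(1)] arc_finite[OF P(1)] by (simp add: card_Un_disjoint)
    ultimately show "odd (card (X \<union> F))" using P(5) by auto
  qed
  have "A \<union> F \<in> circuits G \<and> odd (card (A \<union> F))" "B \<union> F \<in> circuits G \<and> odd (card (B \<union> F))"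
    using circ[OF s(1)] circ[OF s(2)] s(5,6) by auto
  then have "incidence_vector (A \<union> F) + incidence_vector (B \<union> F) \<in>
      F2.span (incidence_vector ` {C \<in> circuits G. odd (card C)})"
    by (intro F2.span_add F2.span_base) auto
  moreover have "(A \<union> F - (B \<union> F)) \<union> (B \<union> F - (A \<union> F)) = D" using s(4,5) P(4) by auto
  ultimately show ?thesis by (simp only: incidence_vector_sym_diff)
qed

lemma span_odd_circuits:
  assumes "multigraph G" "two_connected G" "\<not> bipartite_graph G"
  shows "F2.span (incidence_vector ` {C \<in> circuits G. odd (card C)}) = cycle_space G"
proof
  show "F2.span (incidence_vector ` {C \<in> circuits G. odd (card C)}) \<subseteq> cycle_space G"
    unfolding cycle_space_eq_span_circuits[OF assms(1)] by (intro F2.span_mono image_mono) auto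
  have "incidence_vector C \<in> F2.span (incidence_vector ` {C \<in> circuits G. odd (card C)})"
    if "C \<in> circuits G" for C
    using even_circuit_in_span_odd_circuits[OF assms that] that
    by (cases "even (card C)") (auto intro: F2.span_base)
  then show "cycle_space G \<subseteq> F2.span (incidence_vector ` {C \<in> circuits G. odd (card C)})"
    unfolding cycle_space_eq_span_circuits[OF assms(1)] by (intro F2.span_minimal) auto
qed

text \<open>A maximal independent subset of the spanning family of odd circuits is a basis. It is
  the candidate for (ii), and the odd basis to which (iii) is applied.\<close>

lemma odd_circuit_basis_exists:
  assumes "multigraph G" "two_connected G" "\<not> bipartite_graph G"
  shows "\<exists>B. circuit_basis G B \<and> odd_cycle_basis G B"
proof -
  let ?O = "{C \<in> circuits G. odd (card C)}"
  obtain X where X: "X \<subseteq> incidence_vector ` ?O" "F2.independent X" "incidence_vector ` ?O \<subseteq> F2.span X"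
    using F2.maximal_independent_subset by blast
  then obtain B where B: "B \<subseteq> ?O" "X = incidence_vector ` B" by (meson subset_image_iff)
  have "F2.span X = F2.span (incidence_vector ` ?O)"
    using X(1,3) by (meson F2.span_mono F2.span_minimal F2.subspace_span subset_antisym)
  then have "cycle_basis G B"
    using B X(2) span_odd_circuits[OF assms] circuits_subset_cycles[of G] by (auto simp: cycle_basis_def)
  then show ?thesis using B(1) by (auto simp: circuit_basis_def odd_cycle_basis_def)
qed

section \<open>Odd circuits in an odd-C3+-free graph\<close>

text \<open>The ends of the ear cut the odd circuit into an odd and an even arc. Together with an
  odd ear these would form a forbidden theta graph.\<close>

lemma odd_circuit_even_ear:
  assumes G: "multigraph G" and free: "odd_C3_plus_free G"
    and C: "circuit_graph C" "subgraph C G" "odd (card (edges C))"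
    and P: "arc (ends G) u F W v" "u \<noteq> v" "W \<inter> verts C = {u, v}" "F \<subseteq> edges G - edges C"
  shows "even (card F)"
proof (rule ccontr)
  assume odd: "odd (card F)"
  have "u \<in> verts C" "v \<in> verts C" using P(3) by auto
  moreover have "\<And>e. e \<in> edges C \<Longrightarrow> ends C e = ends G e" using C(2) by (auto simp: subgraph_def)
  ultimately obtain A WA B WB where s: "arc (ends G) u A WA v" "arc (ends G) u B WB v" "WA \<inter> WB = {u, v}"
    "A \<inter> B = {}" "A \<union> B = edges C" "WA \<union> WB = verts C"
    using circuit_split_in[OF C(1), of G u v] P(2) by metis
  have sub: "A \<subseteq> edges G" "B \<subseteq> edges G" "F \<subseteq> edges G" using s(5) C(2) P(4) by (auto simp: subgraph_def)
  have uv: "u \<in> WA" "v \<in> WA" "u \<in> WB" "v \<in> WB" using s(3) by auto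
  then have int: "WA \<inter> W = {u, v}" "WB \<inter> W = {u, v}" "WB \<inter> WA = {u, v}" using P(3) s(3,6) by auto
  have disj: "A \<inter> F = {}" "B \<inter> F = {}" "B \<inter> A = {}" using s(4,5) P(4) by auto
  have "card (edges C) = card A + card B"
    using s(4,5) arc_finite[OF s(1)] arc_finite[OF s(2)] by (metis card_Un_disjoint)
  then consider "odd (card A)" "even (card B)" | "odd (card B)" "even (card A)" using C(3) by auto
  then show False
  proof cases
    case 1
    show ?thesis
      using theta_not_free[OF G P(2) s(1) sub(1) 1(1) s(2) sub(2) 1(2) P(1) sub(3) odd s(3) int(1,2) s(4) disj(1,2)]
        free by blast
  next
    case 2
    show ?thesis
      using theta_not_free[OF G P(2) s(2) sub(2) 2(1) s(1) sub(1) 2(2) P(1) sub(3) odd int(3,2,1) disj(3,2,1)]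
        free by blast
  qed
qed

text \<open>All ears of \<open>C\<close> being even, a colouring constant on \<open>C\<close>
  extends so that the edges of \<open>D\<close> outside \<open>C\<close> are exactly its bichromatic
  ones. They are even in number, so an odd number of edges of \<open>D\<close> lies in
  \<open>C\<close>.\<close>

lemma free_imp_odd_circuit_meets_oddly:
  assumes G: "multigraph G" "two_connected G" and free: "odd_C3_plus_free G"
    and C: "C \<in> circuits G" "odd (card C)" and D: "D \<in> circuits G" "odd (card D)"
  shows "odd (card (C \<inter> D))"
proof -
  obtain H where H: "circuit_graph H" "subgraph H G" "edges H = C"
    using C(1) by (auto simp: circuits_def)
  have HG: "verts H \<subseteq> verts G" using H(2) by (simp add: subgraph_def)
  have DG: "D \<subseteq> edges G" using D(1) circuits_subset_Pow by blast
  have ends: "ends G e \<subseteq> verts H" if "e \<in> C" for e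
  proof -
    have "ends H e \<subseteq> verts H" "ends H e = ends G e"
      using that H(2,3) unfolding subgraph_def multigraph_def by blast+
    then show ?thesis by simp
  qed
  \<comment> \<open>For a constant colouring, consistency says precisely that all ears are
    even.\<close>
  have cons: "consistent_ears (ends G) (edges G - C) (verts H) (\<lambda>_. False)"
    unfolding consistent_ears_def using odd_circuit_even_ear[OF G(1) free H(1,2)] H(3) C(2) by blast
  obtain a b where ab: "a \<in> verts H" "b \<in> verts H" "a \<noteq> b" using circuit_two_verts[OF H(1)] .
  have "ends G e \<subseteq> verts H" if "e \<in> edges G - (edges G - C)" for e using ends that by auto
  then obtain c where c: "\<forall>x\<in>verts H. \<not> c x" "\<forall>e\<in>edges G - C. bichromatic (ends G) c e"
    using consistent_ears_colouring[OF G HG ab Diff_subset _ cons] by auto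
  have two: "card (ends G e) = 2" if "e \<in> D" for e using that DG G(1) by (auto simp: multigraph_def)
  have fin: "finite D" using DG G(1) by (meson finite_subset multigraph_def)
  have notC: "\<not> bichromatic (ends G) c e" if "e \<in> C" "e \<in> D" for e
  proof -
    obtain x y where "ends G e = {x, y}" using two[OF \<open>e \<in> D\<close>] by (meson card_2_iff)
    then show ?thesis using ends[OF \<open>e \<in> C\<close>] c(1) by (auto simp: bichromatic_def)
  qed
  have "{e \<in> D. bichromatic (ends G) c e} = D - C" using notC c(2) DG by auto
  then have "even (card (D - C))"
    using even_bichromatic_edges[OF fin two circuit_even_degree[OF D(1)], of c] by simp
  moreover have "card D = card (D - C) + card (C \<inter> D)"
    using fin by (metis Int_commute card_Diff_subset_Int card_mono finite_Int inf_le1 le_add_diff_inverse2)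
  ultimately show ?thesis using D(2) by simp
qed

section \<open>Consequences of a totally odd basis\<close>

text \<open>For two basis elements, equal or not, both sides of the parity identity are 1.
  Bilinearity carries it over to the whole cycle space.\<close>

lemma totally_odd_imp_rank_one:
  assumes G: "multigraph G" and B: "totally_odd_cycle_basis G B"
    and C: "C \<subseteq> edges G" "incidence_vector C \<in> cycle_space G"
    and D: "D \<subseteq> edges G" "incidence_vector D \<in> cycle_space G"
  shows "odd (card (C \<inter> D)) \<longleftrightarrow> odd (card C) \<and> odd (card D)"
proof -
  have fin: "finite (edges G)" using G by (simp add: multigraph_def)
  have BG: "b \<subseteq> edges G" if "b \<in> B" for b
    using that B cycles_subset_Pow[of G]
    by (auto simp: totally_odd_cycle_basis_def odd_cycle_basis_def cycle_basis_def)
  have oddB: "odd (card (b \<inter> b'))" if "b \<in> B" "b' \<in> B" for b b'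
    using that B by (cases "b = b'") (auto simp: totally_odd_cycle_basis_def odd_cycle_basis_def)
  have 1: "(\<Sum>e\<in>edges G. x e * y e) = sum x (edges G) * sum y (edges G)"
    if xy: "x \<in> incidence_vector ` B" "y \<in> incidence_vector ` B" for x y
  proof -
    obtain b b' where b: "b \<in> B" "x = incidence_vector b" "b' \<in> B" "y = incidence_vector b'" using xy by blast
    then show ?thesis
      using oddB[OF b(1,1)] oddB[OF b(1,3)] oddB[OF b(3,3)]
      by (simp add: sum_incidence_vector_mult sum_incidence_vector fin BG del: mult_bit_eq_and)
  qed
  have span: "F2.span (incidence_vector ` B) = cycle_space G"
    using B by (auto simp: totally_odd_cycle_basis_def odd_cycle_basis_def cycle_basis_def)
  have "(\<Sum>e\<in>edges G. incidence_vector C e * incidence_vector D e) =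
      sum (incidence_vector C) (edges G) * sum (incidence_vector D) (edges G)"
    using rank_one_form_span[OF 1] C(2) D(2) unfolding span[symmetric] by blast
  then show ?thesis
    unfolding sum_incidence_vector_mult[OF fin C(1)] sum_incidence_vector[OF fin C(1)]
      sum_incidence_vector[OF fin D(1)]
    by (auto split: if_splits)
qed

text \<open>With the edge \<open>None\<close> added, all degrees at vertices of the path are two.
  Parities of degrees suffice for membership in the cycle space, so the path need not be turned back
  into an arc.\<close>

lemma path_joining_degree:
  assumes "path_joining {u, v} P"
  shows "finite (edges P)" "odd (card {e \<in> edges P. x \<in> ends P e}) \<longleftrightarrow> x \<in> {u, v}"
proof -
  let ?C = "add_new_edge P {u, v}"
  have C: "multigraph ?C" "\<And>x. x \<in> verts P \<Longrightarrow> degree ?C x = 2"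
    using assms by (auto simp: path_joining_def circuit_graph_def add_new_edge_def)
  show fin: "finite (edges P)" using C(1) by (auto simp: multigraph_def add_new_edge_def finite_image_iff)
  have uv: "u \<in> verts P" "v \<in> verts P" using C(1) by (auto simp: multigraph_def add_new_edge_def)
  have "{e \<in> edges ?C. x \<in> ends ?C e} =
      (if x \<in> {u, v} then {None} else {}) \<union> Some ` {e \<in> edges P. x \<in> ends P e}"
    by (auto simp: add_new_edge_def)
  then have "degree ?C x = (if x \<in> {u, v} then 1 else 0) + card {e \<in> edges P. x \<in> ends P e}"
    using fin by (auto simp: degree_def card_image card_insert_if)
  moreover have "card {e \<in> edges P. x \<in> ends P e} = 0" if "x \<notin> verts P"
    using that C(1) by (auto simp: multigraph_def add_new_edge_def card_eq_0_iff)
  ultimately show "odd (card {e \<in> edges P. x \<in> ends P e}) \<longleftrightarrow> x \<in> {u, v}"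
    using C(2)[of x] uv by (cases "x \<in> verts P") (auto split: if_splits)
qed

text \<open>In an odd-C3+, the two paths through the middle vertex form an odd element of the cycle
  space with either of the two paths replacing the doubled edge. These two elements share just the
  first two paths, an even number of edges, against the parity identity.\<close>

lemma totally_odd_imp_free:
  fixes G :: "('v, 'e) mgraph"
  assumes G: "multigraph G" and B: "totally_odd_cycle_basis G B"
  shows "odd_C3_plus_free G"
proof (rule ccontr)
  assume "\<not> odd_C3_plus_free G"
  then obtain S where S: "subgraph S G" "totally_odd_subdivision C3_plus S"
    by (auto simp: odd_C3_plus_free_def)
  from S(2)[unfolded totally_odd_subdivision_def] show False
  proof (elim conjE exE)
    fix \<phi> :: "nat \<Rightarrow> 'v" and Q :: "nat \<Rightarrow> ('v, 'e) mgraph"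
    assume inj: "inj_on \<phi> (verts C3_plus)"
      and Q: "\<forall>e\<in>edges C3_plus. subgraph (Q e) S \<and> path_joining (\<phi> ` ends C3_plus e) (Q e) \<and>
        odd (card (edges (Q e))) \<and> (verts (Q e) - \<phi> ` ends C3_plus e) \<inter> \<phi> ` verts C3_plus = {}"
      and disj: "\<forall>e\<in>edges C3_plus. \<forall>f\<in>edges C3_plus. e \<noteq> f \<longrightarrow> edges (Q e) \<inter> edges (Q f) = {} \<and>
        (verts (Q e) - \<phi> ` ends C3_plus e) \<inter> (verts (Q f) - \<phi> ` ends C3_plus f) = {}"
    define E where "E = (\<lambda>i. edges (Q i))"
    define d where "d = (\<lambda>i x. card {e \<in> E i. x \<in> ends G e})"
    have pj: "path_joining {\<phi> 0, \<phi> 1} (Q 0)" "path_joining {\<phi> 1, \<phi> 2} (Q 1)"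
      "path_joining {\<phi> 0, \<phi> 2} (Q 2)" "path_joining {\<phi> 0, \<phi> 2} (Q 3)"
      using Q by (simp_all add: C3_plus_def)
    have C3: "edges C3_plus = {0, 1, 2, 3}" by (simp add: C3_plus_def)
    have sub: "E i \<subseteq> edges G" and en: "\<And>e. e \<in> E i \<Longrightarrow> ends (Q i) e = ends G e"
      and oddE: "odd (card (E i))" if "i \<in> {0, 1, 2, 3}" for i
      using bspec[OF Q, of i] S(1) that unfolding C3 E_def by (auto simp: subgraph_def)
    have fin: "finite (E 0)" "finite (E 1)" "finite (E 2)" "finite (E 3)"
      using pj[THEN path_joining_degree(1)] unfolding E_def by auto
    have d_eq: "d i x = card {e \<in> edges (Q i). x \<in> ends (Q i) e}" if "i \<in> {0, 1, 2, 3}" for i x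
    proof -
      have "{e \<in> E i. x \<in> ends G e} = {e \<in> edges (Q i). x \<in> ends (Q i) e}" using en[OF that] by (auto simp: E_def)
      then show ?thesis by (simp add: d_def)
    qed
    have deg: "odd (d 0 x) \<longleftrightarrow> x \<in> {\<phi> 0, \<phi> 1}" "odd (d 1 x) \<longleftrightarrow> x \<in> {\<phi> 1, \<phi> 2}"
      "odd (d 2 x) \<longleftrightarrow> x \<in> {\<phi> 0, \<phi> 2}" "odd (d 3 x) \<longleftrightarrow> x \<in> {\<phi> 0, \<phi> 2}" for x
      using path_joining_degree(2)[OF pj(1), of x] path_joining_degree(2)[OF pj(2), of x]
        path_joining_degree(2)[OF pj(3), of x] path_joining_degree(2)[OF pj(4), of x]
      by (simp_all add: d_eq)
    have neq: "\<phi> 0 \<noteq> \<phi> 1" "\<phi> 1 \<noteq> \<phi> 2" "\<phi> 0 \<noteq> \<phi> 2"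
      using inj by (auto simp: C3_plus_def inj_on_def)
    have dj: "E i \<inter> E j = {}" if "i \<in> {0, 1, 2, 3}" "j \<in> {0, 1, 2, 3}" "i \<noteq> j" for i j
      using disj that unfolding E_def C3 by blast
    define Z where "Z = (\<lambda>i. E 0 \<union> E 1 \<union> E i)"
    have Z: "incidence_vector (Z i) \<in> cycle_space G \<and> Z i \<subseteq> edges G \<and> odd (card (Z i))" if i: "i \<in> {2, 3}" for i
    proof -
      have i': "i \<in> {0, 1, 2, 3}" using i by auto
      have dj': "E 0 \<inter> E 1 = {}" "(E 0 \<union> E 1) \<inter> E i = {}" "finite (E i)"
        using dj[of 0 1] dj[of 0 i] dj[of 1 i] i fin by auto
      have sub': "Z i \<subseteq> edges G" using sub[of 0] sub[of 1] sub[OF i'] by (auto simp: Z_def)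
      have "even (card {e \<in> Z i. x \<in> ends G e})" for x
      proof -
        have "{e \<in> Z i. x \<in> ends G e} =
            ({e \<in> E 0. x \<in> ends G e} \<union> {e \<in> E 1. x \<in> ends G e}) \<union> {e \<in> E i. x \<in> ends G e}"
          by (auto simp: Z_def)
        also have "card \<dots> = card ({e \<in> E 0. x \<in> ends G e} \<union> {e \<in> E 1. x \<in> ends G e}) + d i x"
          unfolding d_def using fin dj' by (intro card_Un_disjoint) auto
        also have "card ({e \<in> E 0. x \<in> ends G e} \<union> {e \<in> E 1. x \<in> ends G e}) = d 0 x + d 1 x"
          unfolding d_def using fin dj' by (intro card_Un_disjoint) auto
        finally have "card {e \<in> Z i. x \<in> ends G e} = d 0 x + d 1 x + d i x" .
        moreover have "odd (d i x) \<longleftrightarrow> x \<in> {\<phi> 0, \<phi> 2}" using i deg by auto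
        ultimately show ?thesis using deg(1,2)[of x] neq by auto
      qed
      moreover have "card (Z i) = card (E 0) + card (E 1) + card (E i)"
        unfolding Z_def using fin dj' by (simp add: card_Un_disjoint)
      ultimately show ?thesis
        using even_degrees_in_cycle_space[OF G sub'] sub' oddE[of 0] oddE[of 1] oddE[OF i'] by auto
    qed
    have "odd (card (Z 2 \<inter> Z 3))"
      using totally_odd_imp_rank_one[OF G B, of "Z 2" "Z 3"] Z[of 2] Z[of 3] by auto
    moreover have "Z 2 \<inter> Z 3 = E 0 \<union> E 1" using dj[of 2 3] by (auto simp: Z_def)
    moreover have "card (E 0 \<union> E 1) = card (E 0) + card (E 1)"
      using fin dj[of 0 1] by (simp add: card_Un_disjoint)
    ultimately show False using oddE[of 0] oddE[of 1] by simp
  qed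
qed

theorem theorem2p2:
  fixes G :: "('v, 'e) mgraph"
  assumes "multigraph G" and "two_connected G" and "\<not> bipartite_graph G"
  shows "(odd_C3_plus_free G \<longleftrightarrow> (\<exists>B. circuit_basis G B \<and> totally_odd_cycle_basis G B)) \<and>
    ((\<exists>B. circuit_basis G B \<and> totally_odd_cycle_basis G B) \<longleftrightarrow>
      (\<forall>B. odd_cycle_basis G B \<longrightarrow> totally_odd_cycle_basis G B))"
proof -
  obtain B where B: "circuit_basis G B" "odd_cycle_basis G B"
    using odd_circuit_basis_exists[OF assms] by blast
  \<comment> \<open>The elements of \<open>B\<close> are odd circuits, so any two of them share an
    odd number of edges.\<close>
  have 1: "totally_odd_cycle_basis G B" if "odd_C3_plus_free G"
    using free_imp_odd_circuit_meets_oddly[OF assms(1,2) that] B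
    by (auto simp: totally_odd_cycle_basis_def circuit_basis_def odd_cycle_basis_def subset_iff)
  \<comment> \<open>A single totally odd basis \<open>T\<close> yields the parity identity on the
    whole cycle space, which then applies to any odd basis.\<close>
  have 2: "totally_odd_cycle_basis G B'"
    if T: "totally_odd_cycle_basis G T" and B': "odd_cycle_basis G B'" for T B'
  proof -
    have "C \<subseteq> edges G \<and> incidence_vector C \<in> cycle_space G \<and> odd (card C)" if "C \<in> B'" for C
    proof -
      have "C \<in> cycles G" "odd (card C)"
        using that B' by (auto simp: odd_cycle_basis_def cycle_basis_def)
      then show ?thesis
        using cycles_subset_Pow[of G] F2.span_base[of "incidence_vector C" "incidence_vector ` cycles G"]
        by (auto simp: cycle_space_def)
    qed
    then have "odd (card (C \<inter> D))" if "C \<in> B'" "D \<in> B'" for C D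
      using totally_odd_imp_rank_one[OF assms(1) T] that by blast
    then show ?thesis using B' by (simp add: totally_odd_cycle_basis_def)
  qed
  show ?thesis using 1 2 B totally_odd_imp_free[OF assms(1)] by blast
qed

end
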